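(* Let $(\Sigma,g)$ be an $n$-dimensional submanifold of a pseudo-Riemannian manifold $(M,\eta)$, with induced (nondegenerate) metric $g$, equipped with an $(N+1)$-multilinear bracket satisfying the compatibility relation described in the context, and let $\mathcal{D}$, $\Pi$, $\hat\nabla$ be defined from the bracket as in the context. Let $\bar R$ denote the curvature tensor of $(M,\eta)$ and let $\mathrm{Ric}$ and $S$ denote the Ricci and scalar curvatures of $(\Sigma,g)$. Then for all $X,Y\in T\Sigma$, $$\mathrm{Ric}(X,Y)=\Big(\mathcal{D}^{kl}\bar R_{kilj}+(\hat\nabla_k\Pi^{kl})(\hat\nabla_j\Pi_{il})-(\hat\nabla_k\Pi_{li})(\hat\nabla_j\Pi^{lk})\Big)X^iY^j,$$ and $$S=\mathcal{D}^{ij}\mathcal{D}^{kl}\bar R_{kilj}+(\hat\nabla^k\Pi_{kl})(\hat\nabla_i\Pi^{il})-(\hat\nabla_k\Pi_{il})(\hat\nabla^i\Pi^{kl}).$$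
   Context: Setting. $(M,\eta)$ is a pseudo-Riemannian manifold of dimension $m$ with Levi-Civita connection $\bar\nabla$ (Christoffel symbols $\bar\Gamma^i_{jk}$) and local coordinates $x^1,\dots,x^m$; $(\Sigma,g)$ is an $n$-dimensional submanifold with induced nondegenerate metric $g$ and Levi-Civita connection $\nabla$, given locally by $x^i(u^1,\dots,u^n)$. Everything is local in these coordinates. Indices $i,j,k,\dots$ run over $1,\dots,m$ and are raised and lowered with $\eta$; $a,b,c,\dots$ run over $1,\dots,n$; repeated indices are summed. $T\Sigma$ is regarded as a subspace of $TM$ (along $\Sigma$) with basis $e_a=(\partial_a x^i)\partial_i$, and $g_{ab}=\eta(e_a,e_b)$, with inverse $g^{ab}$. Bracket. $\{\cdot,\dots,\cdot\}$ is an $(N+1)$-multilinear map $C^\infty(\Sigma)^{N+1}\to C^\infty(\Sigma)$ satisfying the Leibniz rule in each argument (antisymmetry is not assumed). For a multi-index $I=(i_1\cdots i_N)$ write $\{f,\vec x^I\}=\{f,x^{i_1},\dots,x^{i_N}\}$, $\eta_{IJ}=\eta_{i_1j_1}\cdots\eta_{i_Nj_N}$ and $\mathcal{P}^{iI}=\frac1{\sqrt{N!}}\{x^i,\vec x^I\}$. Compatibility assumption: there are $\gamma\in C^\infty(\Sigma)$ with $\gamma>0$ and $\epsilon\in\{-1,1\}$ such that $\mathcal{P}^{iI}\mathcal{P}^{jJ}\eta_{IJ}=\epsilon\gamma^2g^{ab}(\partial_ax^i)(\partial_bx^j)$. Derived objects. $\mathcal{D}^{ij}=\frac{\epsilon}{\gamma^2}\mathcal{P}^{iI}\mathcal{P}^{jJ}\eta_{IJ}$,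 $\mathcal{D}(X)=\mathcal{D}^{ij}\eta_{jk}X^k\partial_i$ for $X\in TM$, and $\Pi=\mathrm{id}-\mathcal{D}$ (components ${\Pi^i}_k=\delta^i_k-{\mathcal{D}^i}_k$). $\hat\nabla_XT=\bar\nabla_{\mathcal{D}(X)}T$ for tensors $T$ of $M$ along $\Sigma$, i.e. $\hat\nabla_j={\mathcal{D}_j}^l\bar\nabla_l$ (this differentiates only in directions tangent to $\Sigma$), and $\hat\nabla^i=\eta^{ij}\hat\nabla_j$. In bracket form, with $\mathcal{D}^i(f)=\frac{\epsilon}{\gamma^2N!}\{x^i,\vec x^I\}\{f,\vec x^J\}\eta_{IJ}$, one has $\hat\nabla_jY^i=\mathcal{D}_j(Y^i)+{\mathcal{D}_j}^l\bar\Gamma^i_{lk}Y^k$. Curvature conventions. $R(X,Y)Z=\nabla_X\nabla_YZ-\nabla_Y\nabla_XZ-\nabla_{[X,Y]}Z$ (same for $\bar R$); $\bar R_{ijkl}=\eta(\bar R(\partial_k,\partial_l)\partial_j,\partial_i)$; $\mathrm{Ric}(X,Y)$ is the trace over $T\Sigma$ of $V\mapsto R(V,X)Y$; $S=g^{ab}\mathrm{Ric}(e_a,e_b)$. *)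

theory Defs
  imports "HOL-Analysis.Analysis"
begin

text \<open>
  The ambient manifold is a coordinate domain \<open>V\<close> in \<open>real^'m\<close>, with metric components
  \<open>\<eta> :: real^'m \<Rightarrow> real^'m^'m\<close>; the submanifold is a parametrized patch
  \<open>x :: real^'n \<Rightarrow> real^'m\<close> on a coordinate domain \<open>U\<close> in \<open>real^'n\<close>, and functions and tensors
  along the submanifold are functions of \<open>u \<in> U\<close>.
\<close>

fun ck_on :: "'a::real_normed_vector set \<Rightarrow> nat \<Rightarrow> ('a \<Rightarrow> 'b::real_normed_vector) \<Rightarrow> bool" where
  "ck_on S 0 f \<longleftrightarrow> continuous_on S f"
| "ck_on S (Suc k) f \<longleftrightarrow>
     (\<forall>p\<in>S. f differentiable (at p)) \<and> (\<forall>v. ck_on S k (\<lambda>p. frechet_derivative f (at p) v))"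

text \<open>Meant for open \<open>S\<close>; values of \<open>f\<close> outside \<open>S\<close> are then irrelevant.\<close>

definition smooth_on :: "'a::real_normed_vector set \<Rightarrow> ('a \<Rightarrow> 'b::real_normed_vector) \<Rightarrow> bool" where
  "smooth_on S f \<longleftrightarrow> (\<forall>k. ck_on S k f)"

abbreviation pd :: "'k \<Rightarrow> (real^'k::finite \<Rightarrow> 'b::real_normed_vector) \<Rightarrow> real^'k \<Rightarrow> 'b" where
  "pd a f p \<equiv> frechet_derivative f (at p) (axis a 1)"


section \<open>Pseudo-Riemannian geometry in a coordinate domain\<close>

definition pseudo_riemannian_metric ::
    "(real^'k::finite) set \<Rightarrow> (real^'k \<Rightarrow> real^'k^'k) \<Rightarrow> bool" where
  "pseudo_riemannian_metric V h \<longleftrightarrow>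
     open V \<and> smooth_on V h \<and> (\<forall>p\<in>V. transpose (h p) = h p \<and> invertible (h p))"

text \<open>\<open>christoffel h i j k\<close> is the symbol with upper index \<open>i\<close> and lower indices \<open>j\<close>, \<open>k\<close>.\<close>

definition christoffel ::
    "(real^'k::finite \<Rightarrow> real^'k^'k) \<Rightarrow> 'k \<Rightarrow> 'k \<Rightarrow> 'k \<Rightarrow> real^'k \<Rightarrow> real" where
  "christoffel h i j k p =
     (\<Sum>l\<in>UNIV. matrix_inv (h p) $ i $ l *
        (pd j h p $ l $ k + pd k h p $ l $ j - pd l h p $ j $ k)) / 2"

definition levi_civita ::
    "(real^'k::finite \<Rightarrow> real^'k^'k) \<Rightarrow> (real^'k \<Rightarrow> real^'k) \<Rightarrow> (real^'k \<Rightarrow> real^'k)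
       \<Rightarrow> (real^'k \<Rightarrow> real^'k)" where
  "levi_civita h X Y p =
     frechet_derivative Y (at p) (X p) +
     (\<chi> i. \<Sum>j\<in>UNIV. \<Sum>k\<in>UNIV. christoffel h i j k p * X p $ j * Y p $ k)"

definition lie_bracket ::
    "(real^'k::finite \<Rightarrow> real^'k) \<Rightarrow> (real^'k \<Rightarrow> real^'k) \<Rightarrow> (real^'k \<Rightarrow> real^'k)" where
  "lie_bracket X Y p =
     frechet_derivative Y (at p) (X p) - frechet_derivative X (at p) (Y p)"

definition curvature ::
    "(real^'k::finite \<Rightarrow> real^'k^'k) \<Rightarrow> (real^'k \<Rightarrow> real^'k) \<Rightarrow> (real^'k \<Rightarrow> real^'k)
       \<Rightarrow> (real^'k \<Rightarrow> real^'k) \<Rightarrow> (real^'k \<Rightarrow> real^'k)" where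
  "curvature h X Y Z p =
     levi_civita h X (levi_civita h Y Z) p - levi_civita h Y (levi_civita h X Z) p
       - levi_civita h (lie_bracket X Y) Z p"

text \<open>\<open>R\<^bsub>ijkl\<^esub> = h(R(\<partial>\<^sub>k, \<partial>\<^sub>l) \<partial>\<^sub>j, \<partial>\<^sub>i)\<close>; coordinate vector fields are constant functions.\<close>

definition riemann_low ::
    "(real^'k::finite \<Rightarrow> real^'k^'k) \<Rightarrow> 'k \<Rightarrow> 'k \<Rightarrow> 'k \<Rightarrow> 'k \<Rightarrow> real^'k \<Rightarrow> real" where
  "riemann_low h i j k l p =
     (h p *v curvature h (\<lambda>_. axis k 1) (\<lambda>_. axis l 1) (\<lambda>_. axis j 1) p) \<bullet> axis i 1"

text \<open>
  Trace of \<open>V \<mapsto> R(V, X) Y\<close>. By tensoriality a tangent vector \<open>v\<close> at \<open>p\<close> may be inserted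
  through any extension to a vector field, here the constant one.
\<close>

definition ricci ::
    "(real^'k::finite \<Rightarrow> real^'k^'k) \<Rightarrow> (real^'k \<Rightarrow> real^'k) \<Rightarrow> (real^'k \<Rightarrow> real^'k)
       \<Rightarrow> (real^'k \<Rightarrow> real)" where
  "ricci h X Y p = trace (matrix (\<lambda>v. curvature h (\<lambda>_. v) X Y p))"

definition scalar_curvature ::
    "(real^'k::finite \<Rightarrow> real^'k^'k) \<Rightarrow> real^'k \<Rightarrow> real" where
  "scalar_curvature h p =
     (\<Sum>a\<in>UNIV. \<Sum>b\<in>UNIV. matrix_inv (h p) $ a $ b * ricci h (\<lambda>_. axis a 1) (\<lambda>_. axis b 1) p)"


section \<open>Submanifold patches\<close>

definition induced_metric ::
    "(real^'m::finite \<Rightarrow> real^'m^'m) \<Rightarrow> (real^'n::finite \<Rightarrow> real^'m) \<Rightarrow> real^'n \<Rightarrow> real^'n^'n" where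
  "induced_metric \<eta> x u = (\<chi> a b. pd a x u \<bullet> (\<eta> (x u) *v pd b x u))"

definition submanifold_patch ::
    "(real^'m::finite) set \<Rightarrow> (real^'m \<Rightarrow> real^'m^'m) \<Rightarrow> (real^'n::finite) set
       \<Rightarrow> (real^'n \<Rightarrow> real^'m) \<Rightarrow> bool" where
  "submanifold_patch V \<eta> U x \<longleftrightarrow>
     open U \<and> smooth_on U x \<and> x ` U \<subseteq> V \<and>
     (\<forall>u\<in>U. inj (frechet_derivative x (at u))) \<and>
     (\<exists>y. homeomorphism U (x ` U) x y) \<and>
     (\<forall>u\<in>U. invertible (induced_metric \<eta> x u))"

text \<open>
  For \<open>W\<close> in \<open>T\<Sigma>\<close>, the components \<open>w\<^sup>a\<close> in \<open>W = w\<^sup>a e\<^sub>a\<close>, i.e. \<open>W\<close> as a tangent vector of the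
  parameter domain; unspecified if \<open>W\<close> is not tangent.
\<close>

definition tangent_components ::
    "(real^'n::finite \<Rightarrow> real^'m::finite) \<Rightarrow> real^'n \<Rightarrow> real^'m \<Rightarrow> real^'n" where
  "tangent_components x u W = (THE w. (\<Sum>a\<in>UNIV. w $ a *\<^sub>R pd a x u) = W)"

text \<open>
  Ambient covariant derivative, in a direction \<open>W\<close> tangent to the submanifold, of a tensor
  along the submanifold with two upper (\<open>nabla_up\<close>) or two lower (\<open>nabla_low\<close>) indices.
\<close>

definition nabla_up ::
    "(real^'m::finite \<Rightarrow> real^'m^'m) \<Rightarrow> (real^'n::finite \<Rightarrow> real^'m) \<Rightarrow> real^'n \<Rightarrow> real^'m
       \<Rightarrow> (real^'n \<Rightarrow> real^'m^'m) \<Rightarrow> 'm \<Rightarrow> 'm \<Rightarrow> real" where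
  "nabla_up \<eta> x u W T i j =
     frechet_derivative T (at u) (tangent_components x u W) $ i $ j +
     (\<Sum>l\<in>UNIV. \<Sum>k\<in>UNIV. W $ l *
        (christoffel \<eta> i l k (x u) * T u $ k $ j + christoffel \<eta> j l k (x u) * T u $ i $ k))"

definition nabla_low ::
    "(real^'m::finite \<Rightarrow> real^'m^'m) \<Rightarrow> (real^'n::finite \<Rightarrow> real^'m) \<Rightarrow> real^'n \<Rightarrow> real^'m
       \<Rightarrow> (real^'n \<Rightarrow> real^'m^'m) \<Rightarrow> 'm \<Rightarrow> 'm \<Rightarrow> real" where
  "nabla_low \<eta> x u W T i j =
     frechet_derivative T (at u) (tangent_components x u W) $ i $ j -
     (\<Sum>l\<in>UNIV. \<Sum>k\<in>UNIV. W $ l *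
        (christoffel \<eta> k l i (x u) * T u $ k $ j + christoffel \<eta> k l j (x u) * T u $ i $ k))"


section \<open>Brackets\<close>

definition smooth_args :: "(real^'n::finite) set \<Rightarrow> nat \<Rightarrow> (real^'n \<Rightarrow> real) list set" where
  "smooth_args U N = {fs. length fs = N + 1 \<and> (\<forall>f\<in>set fs. smooth_on U f)}"

text \<open>
  The bracket \<open>{f\<^sub>0, ..., f\<^sub>N}\<close> is \<open>br [f\<^sub>0, ..., f\<^sub>N]\<close>. Elements of \<open>C\<^sup>\<infinity>(U)\<close> are represented by
  functions on the whole type, so \<open>br\<close> has to respect equality on \<open>U\<close>.
\<close>

definition multi_derivation_bracket ::
    "(real^'n::finite) set \<Rightarrow> nat \<Rightarrow> ((real^'n \<Rightarrow> real) list \<Rightarrow> real^'n \<Rightarrow> real) \<Rightarrow> bool" where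
  "multi_derivation_bracket U N br \<longleftrightarrow>
     (\<forall>fs\<in>smooth_args U N. smooth_on U (br fs)) \<and>
     (\<forall>fs\<in>smooth_args U N. \<forall>hs\<in>smooth_args U N.
        (\<forall>k\<le>N. \<forall>u\<in>U. (fs ! k) u = (hs ! k) u) \<longrightarrow> (\<forall>u\<in>U. br fs u = br hs u)) \<and>
     (\<forall>fs\<in>smooth_args U N. \<forall>k\<le>N. \<forall>f h. smooth_on U f \<and> smooth_on U h \<longrightarrow>
        (\<forall>a b. \<forall>u\<in>U. br (fs[k := (\<lambda>w. a * f w + b * h w)]) u
                        = a * br (fs[k := f]) u + b * br (fs[k := h]) u) \<and>
        (\<forall>u\<in>U. br (fs[k := (\<lambda>w. f w * h w)]) u
                   = f u * br (fs[k := h]) u + br (fs[k := f]) u * h u))"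

definition multi_indices :: "nat \<Rightarrow> 'm list set" where
  "multi_indices N = {I. length I = N}"

definition multi_metric :: "real^'m^'m \<Rightarrow> 'm::finite list \<Rightarrow> 'm list \<Rightarrow> real" where
  "multi_metric A I J = (\<Prod>k<length I. A $ (I ! k) $ (J ! k))"

text \<open>The components \<open>P\<^sup>i\<^sup>I\<close>.\<close>

definition bracket_P ::
    "nat \<Rightarrow> ((real^'n::finite \<Rightarrow> real) list \<Rightarrow> real^'n \<Rightarrow> real) \<Rightarrow> (real^'n \<Rightarrow> real^'m::finite)
       \<Rightarrow> 'm \<Rightarrow> 'm list \<Rightarrow> real^'n \<Rightarrow> real" where
  "bracket_P N br x i I u =
     br ((\<lambda>w. x w $ i) # map (\<lambda>k w. x w $ k) I) u / sqrt (fact N)"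

text \<open>The contraction \<open>P\<^sup>i\<^sup>I P\<^sup>j\<^sup>J \<eta>\<^bsub>IJ\<^esub>\<close>.\<close>

definition bracket_PP ::
    "nat \<Rightarrow> ((real^'n::finite \<Rightarrow> real) list \<Rightarrow> real^'n \<Rightarrow> real) \<Rightarrow> (real^'m::finite \<Rightarrow> real^'m^'m)
       \<Rightarrow> (real^'n \<Rightarrow> real^'m) \<Rightarrow> 'm \<Rightarrow> 'm \<Rightarrow> real^'n \<Rightarrow> real" where
  "bracket_PP N br \<eta> x i j u =
     (\<Sum>I\<in>multi_indices N. \<Sum>J\<in>multi_indices N.
        bracket_P N br x i I u * bracket_P N br x j J u * multi_metric (\<eta> (x u)) I J)"

definition compatible_bracket ::
    "nat \<Rightarrow> ((real^'n::finite \<Rightarrow> real) list \<Rightarrow> real^'n \<Rightarrow> real) \<Rightarrow> (real^'m::finite \<Rightarrow> real^'m^'m)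
       \<Rightarrow> (real^'n) set \<Rightarrow> (real^'n \<Rightarrow> real^'m) \<Rightarrow> (real^'n \<Rightarrow> real) \<Rightarrow> real \<Rightarrow> bool" where
  "compatible_bracket N br \<eta> U x \<gamma> \<epsilon> \<longleftrightarrow>
     smooth_on U \<gamma> \<and> (\<forall>u\<in>U. \<gamma> u > 0) \<and> \<epsilon> \<in> {-1, 1} \<and>
     (\<forall>u\<in>U. \<forall>i j. bracket_PP N br \<eta> x i j u =
        \<epsilon> * (\<gamma> u)\<^sup>2 * (\<Sum>a\<in>UNIV. \<Sum>b\<in>UNIV.
           matrix_inv (induced_metric \<eta> x u) $ a $ b * pd a x u $ i * pd b x u $ j))"

text \<open>The components \<open>D\<^sup>i\<^sup>j\<close>, and the map \<open>D(X)\<close> on vectors of the ambient space.\<close>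

definition bracket_D ::
    "nat \<Rightarrow> ((real^'n::finite \<Rightarrow> real) list \<Rightarrow> real^'n \<Rightarrow> real) \<Rightarrow> (real^'m::finite \<Rightarrow> real^'m^'m)
       \<Rightarrow> (real^'n \<Rightarrow> real^'m) \<Rightarrow> (real^'n \<Rightarrow> real) \<Rightarrow> real \<Rightarrow> real^'n \<Rightarrow> real^'m^'m" where
  "bracket_D N br \<eta> x \<gamma> \<epsilon> u = (\<chi> i j. \<epsilon> / (\<gamma> u)\<^sup>2 * bracket_PP N br \<eta> x i j u)"

definition D_map ::
    "(real^'m::finite \<Rightarrow> real^'m^'m) \<Rightarrow> (real^'n::finite \<Rightarrow> real^'m) \<Rightarrow> (real^'n \<Rightarrow> real^'m^'m)
       \<Rightarrow> real^'n \<Rightarrow> real^'m \<Rightarrow> real^'m" where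
  "D_map \<eta> x D u X = (\<chi> i. \<Sum>j\<in>UNIV. \<Sum>k\<in>UNIV. D u $ i $ j * \<eta> (x u) $ j $ k * X $ k)"

text \<open>\<open>\<Pi> = id - D\<close> with index positions \<open>\<Pi>\<^sup>i\<^sub>k\<close>, \<open>\<Pi>\<^sub>i\<^sub>k\<close> and \<open>\<Pi>\<^sup>i\<^sup>k\<close> respectively.\<close>

definition Pi_mixed ::
    "(real^'m::finite \<Rightarrow> real^'m^'m) \<Rightarrow> (real^'n::finite \<Rightarrow> real^'m) \<Rightarrow> (real^'n \<Rightarrow> real^'m^'m)
       \<Rightarrow> real^'n \<Rightarrow> real^'m^'m" where
  "Pi_mixed \<eta> x D u = matrix (\<lambda>X. X - D_map \<eta> x D u X)"

definition Pi_low ::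
    "(real^'m::finite \<Rightarrow> real^'m^'m) \<Rightarrow> (real^'n::finite \<Rightarrow> real^'m) \<Rightarrow> (real^'n \<Rightarrow> real^'m^'m)
       \<Rightarrow> real^'n \<Rightarrow> real^'m^'m" where
  "Pi_low \<eta> x D u = \<eta> (x u) ** Pi_mixed \<eta> x D u"

definition Pi_up ::
    "(real^'m::finite \<Rightarrow> real^'m^'m) \<Rightarrow> (real^'n::finite \<Rightarrow> real^'m) \<Rightarrow> (real^'n \<Rightarrow> real^'m^'m)
       \<Rightarrow> real^'n \<Rightarrow> real^'m^'m" where
  "Pi_up \<eta> x D u = Pi_mixed \<eta> x D u ** matrix_inv (\<eta> (x u))"

text \<open>
  \<open>hat_up \<eta> x D T k i j u\<close> is the derivative with index \<open>k\<close> down of \<open>T\<^sup>i\<^sup>j\<close>, \<open>hat_low\<close> the same for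
  \<open>T\<^sub>i\<^sub>j\<close>; the \<open>hatr_\<close> versions have the derivative index \<open>k\<close> raised.
\<close>

definition hat_up ::
    "(real^'m::finite \<Rightarrow> real^'m^'m) \<Rightarrow> (real^'n::finite \<Rightarrow> real^'m) \<Rightarrow> (real^'n \<Rightarrow> real^'m^'m)
       \<Rightarrow> (real^'n \<Rightarrow> real^'m^'m) \<Rightarrow> 'm \<Rightarrow> 'm \<Rightarrow> 'm \<Rightarrow> real^'n \<Rightarrow> real" where
  "hat_up \<eta> x D T k i j u = nabla_up \<eta> x u (D_map \<eta> x D u (axis k 1)) T i j"

definition hat_low ::
    "(real^'m::finite \<Rightarrow> real^'m^'m) \<Rightarrow> (real^'n::finite \<Rightarrow> real^'m) \<Rightarrow> (real^'n \<Rightarrow> real^'m^'m)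
       \<Rightarrow> (real^'n \<Rightarrow> real^'m^'m) \<Rightarrow> 'm \<Rightarrow> 'm \<Rightarrow> 'm \<Rightarrow> real^'n \<Rightarrow> real" where
  "hat_low \<eta> x D T k i j u = nabla_low \<eta> x u (D_map \<eta> x D u (axis k 1)) T i j"

definition hatr_up ::
    "(real^'m::finite \<Rightarrow> real^'m^'m) \<Rightarrow> (real^'n::finite \<Rightarrow> real^'m) \<Rightarrow> (real^'n \<Rightarrow> real^'m^'m)
       \<Rightarrow> (real^'n \<Rightarrow> real^'m^'m) \<Rightarrow> 'm \<Rightarrow> 'm \<Rightarrow> 'm \<Rightarrow> real^'n \<Rightarrow> real" where
  "hatr_up \<eta> x D T k i j u = (\<Sum>l\<in>UNIV. matrix_inv (\<eta> (x u)) $ k $ l * hat_up \<eta> x D T l i j u)"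

definition hatr_low ::
    "(real^'m::finite \<Rightarrow> real^'m^'m) \<Rightarrow> (real^'n::finite \<Rightarrow> real^'m) \<Rightarrow> (real^'n \<Rightarrow> real^'m^'m)
       \<Rightarrow> (real^'n \<Rightarrow> real^'m^'m) \<Rightarrow> 'm \<Rightarrow> 'm \<Rightarrow> 'm \<Rightarrow> real^'n \<Rightarrow> real" where
  "hatr_low \<eta> x D T k i j u = (\<Sum>l\<in>UNIV. matrix_inv (\<eta> (x u)) $ k $ l * hat_low \<eta> x D T l i j u)"

end

theory Submission
  imports Defs
begin

text \<open>
  Compatibility says exactly that \<open>D\<^sup>i\<^sup>j = g\<^sup>a\<^sup>b e\<^sub>a\<^sup>i e\<^sub>b\<^sup>j\<close>, so \<open>D\<close> is the orthogonal projection onto the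
  tangent space and \<open>\<Pi>\<close> the one onto the normal space. With the second fundamental form \<open>h\<close>,
  differentiating \<open>\<Pi>(e\<^sub>a, \<cdot>) = 0\<close> gives \<open>(\<nabla>\<^sub>c \<Pi>)(e\<^sub>a, \<cdot>) = - h(c, a)\<close>. Every term of the two formulas
  contracts \<open>\<nabla> \<Pi>\<close> with a tangent vector, since the derivative index is itself tangent; the
  terms therefore become \<open>\<langle>h(X, Y), tr h\<rangle>\<close> and \<open>g\<^sup>a\<^sup>b \<langle>h(X, e\<^sub>b), h(e\<^sub>a, Y)\<rangle>\<close>, and the claim is the
  trace of the Gauss equation. The index order in the curvature term differs from that trace by
  the pair symmetry of the Riemann tensor.
\<close>


section \<open>Second derivatives and differentiable matrix families\<close>

text \<open>The inverse metric is awkward to differentiate, and the proof is shaped to avoid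
  computing its derivative. On the curvature side only pairings such as
  \<open>mform h p a (chris h p b c)\<close> are differentiated, in which the inverse has already
  cancelled. On the side of \<Pi>, only differentiability is established; the needed contractions of
  the derivative are forced by the product rule for a pairing that vanishes identically.

  The other difficulty is that the index of a hat derivative is ambient, while functions along
  \<Sigma> can only be differentiated in parameter directions. Tangent vectors are therefore
  represented by parameter vectors \<open>w\<close> through \<open>E u w\<close>, and
  \<open>D\<close> factors as \<open>E u\<close> after \<open>tcomp u\<close>. Summing an ambient
  index through \<open>tcomp\<close> is what inserts tangent vectors into the other factors.

  Symmetry of second derivatives is used for four objects: \<open>x\<close> (symmetry of the second
  fundamental form), its first derivatives (commuting covariant derivatives), the field
  \<open>Y\<close> (tensoriality of curvature) and \<eta> (pair symmetry).\<close>

lemma second_difference_mvt: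
  fixes f :: "'a::real_normed_vector \<Rightarrow> real"
  assumes h: "0 < h" and S: "\<And>s t. 0 \<le> s \<Longrightarrow> s \<le> h \<Longrightarrow> 0 \<le> t \<Longrightarrow> t \<le> h \<Longrightarrow> p + s *\<^sub>R v + t *\<^sub>R w \<in> S"
    and f: "\<And>q. q \<in> S \<Longrightarrow> f differentiable (at q)"
    and fv: "\<And>q. q \<in> S \<Longrightarrow> (\<lambda>q. frechet_derivative f (at q) v) differentiable (at q)"
  obtains s t where "0 < s" "s < h" "0 < t" "t < h"
    "f (p + h *\<^sub>R v + h *\<^sub>R w) - f (p + h *\<^sub>R v) - f (p + h *\<^sub>R w) + f p =
       h * h * frechet_derivative (\<lambda>q. frechet_derivative f (at q) v) (at (p + s *\<^sub>R v + t *\<^sub>R w)) w"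
proof -
  let ?g = "\<lambda>s. f (p + s *\<^sub>R v + h *\<^sub>R w) - f (p + s *\<^sub>R v)"
  let ?fv = "\<lambda>q. frechet_derivative f (at q) v"
  have dv: "((\<lambda>s. f (p + s *\<^sub>R v + t *\<^sub>R w)) has_real_derivative ?fv (p + s *\<^sub>R v + t *\<^sub>R w)) (at s)"
    if "0 \<le> s" "s \<le> h" "0 \<le> t" "t \<le> h" for s t
  proof -
    have "((\<lambda>s. p + s *\<^sub>R v + t *\<^sub>R w) has_derivative (\<lambda>r. r *\<^sub>R v)) (at s)"
      by (auto intro!: derivative_eq_intros)
    from diff_chain_at[OF this, of f "frechet_derivative f (at (p + s *\<^sub>R v + t *\<^sub>R w))"]
    have "((\<lambda>s. f (p + s *\<^sub>R v + t *\<^sub>R w)) has_derivative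
        (\<lambda>r. frechet_derivative f (at (p + s *\<^sub>R v + t *\<^sub>R w)) (r *\<^sub>R v))) (at s)"
      using f[OF S[OF that]] by (simp add: frechet_derivative_works o_def)
    then show ?thesis
      using linear_frechet_derivative[OF f[OF S[OF that]]]
      by (simp add: has_field_derivative_def linear_cmul mult_commute_abs)
  qed
  have dw: "((\<lambda>t. ?fv (p + s *\<^sub>R v + t *\<^sub>R w)) has_real_derivative
        frechet_derivative ?fv (at (p + s *\<^sub>R v + t *\<^sub>R w)) w) (at t)"
    if "0 \<le> s" "s \<le> h" "0 \<le> t" "t \<le> h" for s t
  proof -
    have "((\<lambda>t. p + s *\<^sub>R v + t *\<^sub>R w) has_derivative (\<lambda>r. r *\<^sub>R w)) (at t)"
      by (auto intro!: derivative_eq_intros)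
    from diff_chain_at[OF this, of ?fv "frechet_derivative ?fv (at (p + s *\<^sub>R v + t *\<^sub>R w))"]
    have "((\<lambda>t. ?fv (p + s *\<^sub>R v + t *\<^sub>R w)) has_derivative
        (\<lambda>r. frechet_derivative ?fv (at (p + s *\<^sub>R v + t *\<^sub>R w)) (r *\<^sub>R w))) (at t)"
      using fv[OF S[OF that]] by (simp add: frechet_derivative_works o_def)
    then show ?thesis
      using linear_frechet_derivative[OF fv[OF S[OF that]]]
      by (simp add: has_field_derivative_def linear_cmul mult_commute_abs)
  qed
  \<comment> \<open>The four-point difference is the increment over [0, h] of \<open>?g\<close>,
    itself a difference in direction \<open>w\<close>. The mean value theorem is applied in
    direction \<open>v\<close> first, and then in direction \<open>w\<close> to the derivative
    \<open>?fv\<close>.\<close>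
  have "\<exists>s. 0 < s \<and> s < h \<and> ?g h - ?g 0 = (h - 0) * (?fv (p + s *\<^sub>R v + h *\<^sub>R w) - ?fv (p + s *\<^sub>R v))"
    using MVT2[OF h, of ?g "\<lambda>s. ?fv (p + s *\<^sub>R v + h *\<^sub>R w) - ?fv (p + s *\<^sub>R v)"]
      DERIV_diff[OF dv[of _ h] dv[of _ 0]] h by auto
  then obtain s where s: "0 < s" "s < h"
    "?g h - ?g 0 = h * (?fv (p + s *\<^sub>R v + h *\<^sub>R w) - ?fv (p + s *\<^sub>R v))" by auto
  have "\<exists>t. 0 < t \<and> t < h \<and> ?fv (p + s *\<^sub>R v + h *\<^sub>R w) - ?fv (p + s *\<^sub>R v + 0 *\<^sub>R w) =
     (h - 0) * frechet_derivative ?fv (at (p + s *\<^sub>R v + t *\<^sub>R w)) w"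
    by (rule MVT2[OF h dw]) (use s in auto)
  then obtain t where t: "0 < t" "t < h" "?fv (p + s *\<^sub>R v + h *\<^sub>R w) - ?fv (p + s *\<^sub>R v) =
     h * frechet_derivative ?fv (at (p + s *\<^sub>R v + t *\<^sub>R w)) w" by auto
  show thesis
    by (rule that[OF s(1,2) t(1,2)]) (use s(3) t(3) in \<open>simp add: algebra_simps\<close>)
qed

lemma smooth_on_differentiable:
  assumes "smooth_on S f" "p \<in> S"
  shows "f differentiable (at p)"
  using assms ck_on.simps(2)[of S 0 f] unfolding smooth_on_def by (metis ck_on.simps(2))

lemma smooth_on_frechet_derivative:
  assumes "smooth_on S f"
  shows "smooth_on S (\<lambda>p. frechet_derivative f (at p) v)"
  using assms unfolding smooth_on_def by (metis ck_on.simps(2))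

lemma smooth_on_continuous_on:
  assumes "smooth_on S f"
  shows "continuous_on S f"
  using assms unfolding smooth_on_def by (metis ck_on.simps(1))

lemma frechet_derivative_eq:
  assumes "(f has_derivative f') (at p)"
  shows "frechet_derivative f (at p) v = f' v"
  using frechet_derivative_at[OF assms] by simp

lemma has_derivative_frechet:
  assumes "f differentiable (at p)"
  shows "(f has_derivative frechet_derivative f (at p)) (at p)"
  using assms by (simp add: frechet_derivative_works)

lemma differentiable_transform_within_open:
  assumes "f differentiable (at p)" "open S" "p \<in> S" "\<And>q. q \<in> S \<Longrightarrow> f q = f' q"
  shows "f' differentiable (at p)"
  using assms has_derivative_transform_within_open[of f _ p UNIV S f']
  unfolding differentiable_def by blast

lemma frechet_derivative_bounded_linear:
  assumes "bounded_linear L" "f differentiable (at p)"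
  shows "frechet_derivative (\<lambda>q. L (f q)) (at p) v = L (frechet_derivative f (at p) v)"
  by (rule frechet_derivative_eq)
    (rule bounded_linear.has_derivative[OF assms(1) has_derivative_frechet[OF assms(2)]])

text \<open>The four-point difference of \<open>second_difference_mvt\<close> is symmetric in
  \<open>v\<close> and \<open>w\<close>. The two mixed derivatives therefore agree when evaluated at
  two suitable points of a small parallelogram at \<open>p\<close>, and continuity excludes a gap
  between their values at \<open>p\<close>.\<close>

lemma symmetric_second_derivative_real:
  fixes f :: "'a::real_normed_vector \<Rightarrow> real"
  assumes S: "open S" "p \<in> S"
    and f: "\<And>q. q \<in> S \<Longrightarrow> f differentiable (at q)"
    and fv: "\<And>q v. q \<in> S \<Longrightarrow> (\<lambda>q. frechet_derivative f (at q) v) differentiable (at q)"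
    and cont: "\<And>v w. continuous_on S (\<lambda>r. frechet_derivative (\<lambda>q. frechet_derivative f (at q) v) (at r) w)"
  shows "frechet_derivative (\<lambda>q. frechet_derivative f (at q) v) (at p) w =
         frechet_derivative (\<lambda>q. frechet_derivative f (at q) w) (at p) v"
proof (rule ccontr)
  let ?D = "\<lambda>v w r. frechet_derivative (\<lambda>q. frechet_derivative f (at q) v) (at r) w"
  assume ne: "\<not> ?thesis"
  \<comment> \<open>Half the gap: numbers within \<open>e\<close> of the two different mixed
    derivatives at \<open>p\<close> cannot be equal.\<close>
  define e where "e = \<bar>?D v w p - ?D w v p\<bar> / 2"
  have e: "e > 0" using ne by (simp add: e_def)
  have "\<exists>d>0. \<forall>q. dist q p < d \<longrightarrow> q \<in> S \<and> \<bar>?D v w q - ?D v w p\<bar> < e" for v w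
  proof -
    have "\<forall>\<^sub>F q in nhds p. q \<in> S" using S by (simp add: eventually_nhds_in_open)
    moreover have "\<forall>\<^sub>F q in nhds p. dist (?D v w q) (?D v w p) < e"
      using cont[of v w] S e
      by (metis continuous_on_eq_continuous_at isCont_def tendstoD tendsto_at_iff_tendsto_nhds)
    ultimately show ?thesis
      unfolding eventually_nhds_metric dist_real_def by (metis min_less_iff_conj)
  qed
  then obtain d1 d2 where d: "d1 > 0" "d2 > 0"
    "\<And>q. dist q p < d1 \<Longrightarrow> q \<in> S \<and> \<bar>?D v w q - ?D v w p\<bar> < e"
    "\<And>q. dist q p < d2 \<Longrightarrow> \<bar>?D w v q - ?D w v p\<bar> < e" by meson
  \<comment> \<open>The summand 1 keeps the divisor positive when \<open>v\<close> and
    \<open>w\<close> both vanish. With this side length the whole parallelogram lies closer to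
    \<open>p\<close> than both \<open>d1\<close> and \<open>d2\<close>.\<close>
  define h where "h = min d1 d2 / (norm v + norm w + 1) / 2"
  have n: "norm v + norm w + 1 > 0" by (simp add: add_nonneg_pos)
  have h: "h > 0" using d n by (simp add: h_def)
  have close: "dist (p + s *\<^sub>R v + t *\<^sub>R w) p < min d1 d2" if "0 \<le> s" "s \<le> h" "0 \<le> t" "t \<le> h" for s t
  proof -
    have "dist (p + s *\<^sub>R v + t *\<^sub>R w) p \<le> s * norm v + t * norm w"
      using norm_triangle_ineq[of "s *\<^sub>R v" "t *\<^sub>R w"] that by (simp add: dist_norm add.assoc)
    also have "\<dots> \<le> h * norm v + h * norm w" using that by (intro add_mono mult_right_mono) auto
    also have "\<dots> < h * (norm v + norm w + 1)" using h by (simp add: algebra_simps)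
    also have "\<dots> = min d1 d2 / 2"
    proof -
      have "a / c / 2 * c = a / 2" if "c > 0" for a c :: real using that by simp
      from this[OF n] show ?thesis unfolding h_def .
    qed
    also have "\<dots> \<le> min d1 d2" using d(1,2) by (simp add: min_def)
    finally show ?thesis .
  qed
  obtain s t where st: "0 < s" "s < h" "0 < t" "t < h"
    "f (p + h *\<^sub>R v + h *\<^sub>R w) - f (p + h *\<^sub>R v) - f (p + h *\<^sub>R w) + f p =
       h * h * ?D v w (p + s *\<^sub>R v + t *\<^sub>R w)"
    by (rule second_difference_mvt[OF h, of p v w S f]) (use close d f fv in auto)
  obtain s' t' where st': "0 < s'" "s' < h" "0 < t'" "t' < h"
    "f (p + h *\<^sub>R w + h *\<^sub>R v) - f (p + h *\<^sub>R w) - f (p + h *\<^sub>R v) + f p =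
       h * h * ?D w v (p + s' *\<^sub>R w + t' *\<^sub>R v)"
  proof (rule second_difference_mvt[OF h, of p w v S f])
    show "p + s *\<^sub>R w + t *\<^sub>R v \<in> S" if "0 \<le> s" "s \<le> h" "0 \<le> t" "t \<le> h" for s t
      using close[of t s] that d(3)[of "p + t *\<^sub>R v + s *\<^sub>R w"] by (simp add: algebra_simps)
  qed (use f fv in auto)
  have "h * h * ?D v w (p + s *\<^sub>R v + t *\<^sub>R w) = h * h * ?D w v (p + t' *\<^sub>R v + s' *\<^sub>R w)"
    using st(5) st'(5) by (simp add: algebra_simps)
  then have "?D v w (p + s *\<^sub>R v + t *\<^sub>R w) = ?D w v (p + t' *\<^sub>R v + s' *\<^sub>R w)" using h by simp
  moreover have "\<bar>?D v w (p + s *\<^sub>R v + t *\<^sub>R w) - ?D v w p\<bar> < e"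
    using close[of s t] st d by auto
  moreover have "\<bar>?D w v (p + t' *\<^sub>R v + s' *\<^sub>R w) - ?D w v p\<bar> < e"
    using close[of t' s'] st' d by auto
  ultimately show False unfolding e_def by (simp add: abs_if split: if_splits)
qed

text \<open>The mean value argument is confined to real functions, so it is applied to the
  components along each basis vector.\<close>

lemma smooth_on_symmetric_second_derivative:
  fixes f :: "'a::real_normed_vector \<Rightarrow> 'b::euclidean_space"
  assumes S: "open S" "p \<in> S" and f: "smooth_on S f"
  shows "frechet_derivative (\<lambda>q. frechet_derivative f (at q) v) (at p) w =
         frechet_derivative (\<lambda>q. frechet_derivative f (at q) w) (at p) v"
proof (rule euclidean_eqI)
  fix b :: 'b
  assume "b \<in> Basis"
  have D1: "frechet_derivative (\<lambda>q. f q \<bullet> b) (at q) v = frechet_derivative f (at q) v \<bullet> b"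
    if "q \<in> S" for q v
    using frechet_derivative_bounded_linear[OF bounded_linear_inner_left, of f q b v]
      smooth_on_differentiable[OF f that] by simp
  note fv = smooth_on_frechet_derivative[OF f]
  have D2: "((\<lambda>q. frechet_derivative (\<lambda>q. f q \<bullet> b) (at q) v) has_derivative
      (\<lambda>w. frechet_derivative (\<lambda>q. frechet_derivative f (at q) v) (at q) w \<bullet> b)) (at q)"
    if "q \<in> S" for q v
    by (rule has_derivative_transform_within_open[OF _ S(1) that])
      (use D1 bounded_linear.has_derivative[OF bounded_linear_inner_left
          has_derivative_frechet[OF smooth_on_differentiable[OF fv that]]] in auto)
  have "frechet_derivative (\<lambda>q. frechet_derivative (\<lambda>q. f q \<bullet> b) (at q) v) (at p) w =
        frechet_derivative (\<lambda>q. frechet_derivative (\<lambda>q. f q \<bullet> b) (at q) w) (at p) v"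
  proof (rule symmetric_second_derivative_real[OF S])
    show "(\<lambda>q. f q \<bullet> b) differentiable at q" if "q \<in> S" for q
      using smooth_on_differentiable[OF f that] by (rule differentiable_inner) simp
    show "(\<lambda>q. frechet_derivative (\<lambda>q. f q \<bullet> b) (at q) v) differentiable at q" if "q \<in> S" for q v
      using D2[OF that] by (auto simp: differentiable_def)
    show "continuous_on S (\<lambda>r. frechet_derivative (\<lambda>q. frechet_derivative (\<lambda>q. f q \<bullet> b) (at q) v) (at r) w)" for v w
      using smooth_on_continuous_on[OF smooth_on_frechet_derivative[OF fv, of v w]]
      by (subst continuous_on_cong[OF refl frechet_derivative_eq[OF D2]]) (auto intro!: continuous_intros)
  qed
  then show "frechet_derivative (\<lambda>q. frechet_derivative f (at q) v) (at p) w \<bullet> b =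
         frechet_derivative (\<lambda>q. frechet_derivative f (at q) w) (at p) v \<bullet> b"
    by (simp add: frechet_derivative_eq[OF D2[OF S(2)]])
qed

section \<open>Componentwise calculus for families of vectors, linear maps and matrices\<close>

lemma differentiable_vec_nth:
  fixes f :: "'a::real_normed_vector \<Rightarrow> ('b::real_normed_vector)^'k::finite"
  assumes "f differentiable (at p)"
  shows "(\<lambda>q. f q $ i) differentiable (at p)"
  using bounded_linear.has_derivative[OF bounded_linear_vec_nth has_derivative_frechet[OF assms]]
  by (auto simp: differentiable_def)

lemma frechet_derivative_vec_nth:
  fixes f :: "'a::real_normed_vector \<Rightarrow> ('b::real_normed_vector)^'k::finite"
  assumes "f differentiable (at p)"
  shows "frechet_derivative (\<lambda>q. f q $ i) (at p) v = frechet_derivative f (at p) v $ i"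
  using assms by (rule frechet_derivative_bounded_linear[OF bounded_linear_vec_nth])

lemma linear_eq_sum_axis:
  fixes F :: "real^'k::finite \<Rightarrow> 'b::real_vector"
  assumes "linear F"
  shows "F w = (\<Sum>a\<in>UNIV. w $ a *\<^sub>R F (axis a 1))"
proof -
  have "F w = F (\<Sum>a\<in>UNIV. w $ a *\<^sub>R axis a 1)" by (simp add: basis_expansion flip: scalar_mult_eq_scaleR)
  then show ?thesis by (simp add: linear_sum[OF assms] linear_cmul[OF assms])
qed

text \<open>Expanding the argument in the standard basis leaves finitely many products.
  Differentiability of \<open>F\<close> at each fixed vector therefore suffices, and no norm on the
  space of linear maps is involved.\<close>

lemma has_derivative_linear_family:
  fixes F :: "'a::real_normed_vector \<Rightarrow> real^'k::finite \<Rightarrow> 'b::real_normed_vector"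
  assumes S: "open S" "p \<in> S"
    and lin: "\<And>q. q \<in> S \<Longrightarrow> linear (F q)"
    and F: "\<And>a. (\<lambda>q. F q a) differentiable (at p)"
    and X: "(X has_derivative X') (at p)"
  shows "((\<lambda>q. F q (X q)) has_derivative
    (\<lambda>v. frechet_derivative (\<lambda>q. F q (X p)) (at p) v + F p (X' v))) (at p)"
proof -
  let ?e = "\<lambda>a::'k. axis a (1::real)"
  have F': "((\<lambda>q. F q (?e a)) has_derivative frechet_derivative (\<lambda>q. F q (?e a)) (at p)) (at p)" for a
    using F by (rule has_derivative_frechet)
  have Xa: "((\<lambda>q. X q $ a) has_derivative (\<lambda>v. X' v $ a)) (at p)" for a
    using X by (rule bounded_linear.has_derivative[OF bounded_linear_vec_nth])
  have fixed: "frechet_derivative (\<lambda>q. F q (X p)) (at p) v =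
     (\<Sum>a\<in>UNIV. X p $ a *\<^sub>R frechet_derivative (\<lambda>q. F q (?e a)) (at p) v)" for v
  proof (rule frechet_derivative_eq)
    show "((\<lambda>q. F q (X p)) has_derivative
      (\<lambda>v. \<Sum>a\<in>UNIV. X p $ a *\<^sub>R frechet_derivative (\<lambda>q. F q (?e a)) (at p) v)) (at p)"
      by (rule has_derivative_transform_within_open[OF _ S, of "\<lambda>q. \<Sum>a\<in>UNIV. X p $ a *\<^sub>R F q (?e a)"])
        (auto intro!: derivative_eq_intros F' simp: linear_eq_sum_axis[OF lin, of _ "X p"])
  qed
  have "((\<lambda>q. \<Sum>a\<in>UNIV. X q $ a *\<^sub>R F q (?e a)) has_derivative
     (\<lambda>v. \<Sum>a\<in>UNIV. X p $ a *\<^sub>R frechet_derivative (\<lambda>q. F q (?e a)) (at p) v + X' v $ a *\<^sub>R F p (?e a))) (at p)"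
    by (intro has_derivative_sum has_derivative_scaleR Xa F')
  then have "((\<lambda>q. \<Sum>a\<in>UNIV. X q $ a *\<^sub>R F q (?e a)) has_derivative
     (\<lambda>v. frechet_derivative (\<lambda>q. F q (X p)) (at p) v + F p (X' v))) (at p)"
    unfolding fixed linear_eq_sum_axis[OF lin[OF S(2)], of "X' _"] sum.distrib .
  then show ?thesis
    by (rule has_derivative_transform_within_open[OF _ S])
      (simp add: linear_eq_sum_axis[OF lin, of _ "X _"])
qed

lemma matrix_inv_mult:
  fixes A :: "real^'k^'k::finite"
  assumes "invertible A"
  shows "A ** matrix_inv A = mat 1" "matrix_inv A ** A = mat 1"
  using assms unfolding invertible_def matrix_inv_def by (metis (mono_tags, lifting) someI_ex)+

text \<open>Cramer's rule for the \<open>j\<close>-th column of the inverse. It makes every entry a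
  quotient of polynomials in the entries of \<open>A\<close>, so inverse metrics can be seen to be
  differentiable.\<close>

lemma matrix_inv_component:
  fixes A :: "real^'k^'k::finite"
  assumes "invertible A"
  shows "matrix_inv A $ i $ j = det (\<chi> a b. if b = i then axis j 1 $ a else A $ a $ b) / det A"
proof -
  have d: "det A \<noteq> 0" using assms by (simp add: invertible_det_nz)
  have "A *v (matrix_inv A *v axis j 1) = axis j 1"
    using assms by (simp add: matrix_vector_mul_assoc matrix_inv_mult)
  then have "matrix_inv A *v axis j 1 = (\<chi> k. det (\<chi> a b. if b = k then axis j 1 $ a else A $ a $ b) / det A)"
    using cramer[OF d] by blast
  moreover have "matrix_inv A $ i $ j = (matrix_inv A *v axis j 1) $ i"
    by (simp add: matrix_vector_mul_component inner_axis)
  ultimately show ?thesis by simp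
qed

lemma differentiable_det:
  fixes A :: "'a::real_normed_vector \<Rightarrow> real^'k^'k::finite"
  assumes "\<And>i j. (\<lambda>q. A q $ i $ j) differentiable (at p)"
  shows "(\<lambda>q. det (A q)) differentiable (at p)"
proof -
  have "(\<lambda>q. \<Prod>i\<in>UNIV. A q $ i $ \<pi> i) differentiable (at p)" for \<pi>
    unfolding differentiable_def
    by (rule exI) (rule has_derivative_prod, rule has_derivative_frechet, rule assms)
  then show ?thesis
    unfolding det_def by (intro differentiable_sum differentiable_mult differentiable_const)
      (auto intro: finite_permutations)
qed

lemma differentiable_matrix_inv:
  fixes A :: "'a::real_normed_vector \<Rightarrow> real^'k^'k::finite"
  assumes S: "open S" "p \<in> S" and inv: "\<And>q. q \<in> S \<Longrightarrow> invertible (A q)"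
    and A: "A differentiable (at p)"
  shows "(\<lambda>q. matrix_inv (A q) $ i $ j) differentiable (at p)"
proof -
  have comp: "(\<lambda>q. A q $ i $ j) differentiable (at p)" for i j
    by (intro differentiable_vec_nth A)
  have entry: "(\<lambda>q. (\<chi> a b. if b = i then axis j 1 $ a else A q $ a $ b) $ a $ b) differentiable (at p)" for a b
    using comp by (cases "b = i") auto
  have "det (A p) \<noteq> 0" using inv[OF S(2)] by (simp add: invertible_det_nz)
  then have "(\<lambda>q. det (\<chi> a b. if b = i then axis j 1 $ a else A q $ a $ b) / det (A q)) differentiable (at p)"
    by (intro differentiable_divide differentiable_det comp entry)
  then show ?thesis
    by (rule differentiable_transform_within_open[OF _ S]) (simp add: matrix_inv_component inv)
qed

lemma smooth_on_const: "smooth_on S (\<lambda>_. c)"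
proof -
  have "ck_on S k (\<lambda>_. c)" for k and c :: 'b
    by (induction k arbitrary: c) auto
  then show ?thesis unfolding smooth_on_def by blast
qed

lemma differentiable_vec_lambda:
  fixes f :: "'a::real_normed_vector \<Rightarrow> ('b::euclidean_space)^'k::finite"
  assumes "\<And>i. (\<lambda>q. f q $ i) differentiable (at p)"
  shows "f differentiable (at p)"
  using assms by (simp add: differentiable_componentwise_within[of f] Basis_vec_def inner_axis)

lemma has_derivative_vec_lambda:
  fixes f :: "'a::real_normed_vector \<Rightarrow> ('b::euclidean_space)^'k::finite"
  assumes "\<And>i. ((\<lambda>q. f q $ i) has_derivative (\<lambda>v. f' v $ i)) (at p)"
  shows "(f has_derivative f') (at p)"
  using bounded_linear.has_derivative[OF bounded_linear_inner_left assms]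
  by (subst has_derivative_componentwise_within) (auto simp: Basis_vec_def inner_axis)

section \<open>Curvature of a metric in coordinates\<close>

text \<open>Vector arguments replace index sums: \<open>mform\<close>, \<open>dmform\<close> and
  \<open>chris\<close> are linear in them, so later computations are bilinear algebra and product
  rules.\<close>

definition mform :: "(real^'k::finite \<Rightarrow> real^'k^'k) \<Rightarrow> real^'k \<Rightarrow> real^'k \<Rightarrow> real^'k \<Rightarrow> real" where
  "mform h p a b = a \<bullet> (h p *v b)"

definition dmform :: "(real^'k::finite \<Rightarrow> real^'k^'k) \<Rightarrow> real^'k \<Rightarrow> real^'k \<Rightarrow> real^'k \<Rightarrow> real^'k \<Rightarrow> real" where
  "dmform h p c a b = a \<bullet> (frechet_derivative h (at p) c *v b)"

definition chris :: "(real^'k::finite \<Rightarrow> real^'k^'k) \<Rightarrow> real^'k \<Rightarrow> real^'k \<Rightarrow> real^'k \<Rightarrow> real^'k" where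
  "chris h p a b = (\<chi> i. \<Sum>j\<in>UNIV. \<Sum>k\<in>UNIV. christoffel h i j k p * a $ j * b $ k)"

text \<open>R(v, x) y computed with constant extensions of the three vectors: Lie brackets vanish,
  leaving derivatives and products of Christoffel terms.\<close>

definition curv :: "(real^'k::finite \<Rightarrow> real^'k^'k) \<Rightarrow> real^'k \<Rightarrow> real^'k \<Rightarrow> real^'k \<Rightarrow> real^'k \<Rightarrow> real^'k" where
  "curv h p v x y =
     frechet_derivative (\<lambda>q. chris h q x y) (at p) v - frechet_derivative (\<lambda>q. chris h q v y) (at p) x
       + chris h p v (chris h p x y) - chris h p x (chris h p v y)"

lemma bounded_linear_matrix_vector_mult_left: "bounded_linear (\<lambda>A::real^'k::finite^'l::finite. A *v b)"
  unfolding linear_conv_bounded_linear[symmetric]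
  by (rule linearI) (simp_all add: matrix_vector_mult_add_rdistrib scaleR_matrix_vector_assoc)

lemma bounded_linear_matrix_form: "bounded_linear (\<lambda>A::real^'k::finite^'k. a \<bullet> (A *v b))"
  unfolding linear_conv_bounded_linear[symmetric]
  by (rule linearI) (simp_all add: matrix_vector_mult_add_rdistrib inner_add_right scaleR_matrix_vector_assoc[symmetric])

lemma linear_mform_right: "linear (mform h p a)"
  by (rule linearI) (simp_all add: mform_def matrix_vector_right_distrib inner_add_right matrix_vector_mult_scaleR)

lemma linear_mform_left: "linear (\<lambda>a. mform h p a b)"
  by (rule linearI) (simp_all add: mform_def inner_add_left)

lemmas mform_linear =
  linear_add[OF linear_mform_right] linear_diff[OF linear_mform_right] linear_cmul[OF linear_mform_right]
  linear_neg[OF linear_mform_right] linear_sum[OF linear_mform_right] linear_0[OF linear_mform_right]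
  linear_add[OF linear_mform_left] linear_diff[OF linear_mform_left] linear_cmul[OF linear_mform_left]
  linear_neg[OF linear_mform_left] linear_sum[OF linear_mform_left] linear_0[OF linear_mform_left]

lemma linear_chris_right: "linear (chris h p a)"
  by (rule linearI) (simp_all add: chris_def vec_eq_iff algebra_simps sum.distrib sum_distrib_left)

lemma linear_chris_left: "linear (\<lambda>a. chris h p a b)"
  by (rule linearI) (simp_all add: chris_def vec_eq_iff algebra_simps sum.distrib sum_distrib_left)

lemma levi_civita_chris:
  "levi_civita h X Y p = frechet_derivative Y (at p) (X p) + chris h p (X p) (Y p)"
  by (simp add: levi_civita_def chris_def)

text \<open>Two derivatives are demanded instead of smoothness, so that the induced metric qualifies
  by two uses of the product rule. Full smoothness enters only in \<open>curv_pair_symmetry\<close>,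
  which is applied to \<eta>.\<close>

locale metric_chart =
  fixes S :: "(real^'k::finite) set" and h :: "real^'k \<Rightarrow> real^'k^'k"
  assumes open_S: "open S"
    and transpose_h: "\<And>p. p \<in> S \<Longrightarrow> transpose (h p) = h p"
    and invertible_h: "\<And>p. p \<in> S \<Longrightarrow> invertible (h p)"
    and h_differentiable: "\<And>p. p \<in> S \<Longrightarrow> h differentiable (at p)"
    and dh_differentiable: "\<And>p v. p \<in> S \<Longrightarrow> (\<lambda>q. frechet_derivative h (at q) v) differentiable (at p)"
begin

lemma mform_sym:
  assumes "p \<in> S" shows "mform h p a b = mform h p b a"
  using transpose_h[OF assms] dot_lmul_matrix[of a "h p" b] unfolding mform_def
  by (metis inner_commute vector_transpose_matrix)

lemma mform_nondegenerate:
  assumes "p \<in> S" "\<And>a. mform h p a b = mform h p a c" shows "b = c"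
proof -
  have "h p *v b = h p *v c" using assms(2) unfolding mform_def
    by (metis inner_commute vector_eq_ldot)
  then have "matrix_inv (h p) *v (h p *v b) = matrix_inv (h p) *v (h p *v c)" by simp
  then show ?thesis by (simp add: matrix_vector_mul_assoc matrix_inv_mult invertible_h assms(1))
qed

lemma dmform_eq:
  assumes "p \<in> S" shows "frechet_derivative (\<lambda>q. mform h q a b) (at p) c = dmform h p c a b"
  unfolding mform_def dmform_def
  by (rule frechet_derivative_bounded_linear[OF bounded_linear_matrix_form h_differentiable[OF assms]])

lemma mform_differentiable:
  assumes "p \<in> S" shows "(\<lambda>q. mform h q a b) differentiable (at p)"
  unfolding mform_def differentiable_def
  by (rule exI) (rule bounded_linear.has_derivative[OF bounded_linear_matrix_form
        has_derivative_frechet[OF h_differentiable[OF assms]]])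

lemma dmform_sym:
  assumes "p \<in> S" shows "dmform h p c a b = dmform h p c b a"
proof -
  have "frechet_derivative (\<lambda>q. mform h q a b) (at p) = frechet_derivative (\<lambda>q. mform h q b a) (at p)"
    by (rule frechet_derivative_transform_within_open[OF mform_differentiable[OF assms] open_S assms])
      (rule mform_sym)
  then show ?thesis by (simp flip: dmform_eq[OF assms])
qed

lemma linear_dmform_left:
  assumes "p \<in> S" shows "linear (\<lambda>c. dmform h p c a b)"
  by (rule linearI) (simp_all add: dmform_def inner_add_right matrix_vector_mult_add_rdistrib
      linear_add[OF linear_frechet_derivative] linear_cmul[OF linear_frechet_derivative]
      h_differentiable assms scaleR_matrix_vector_assoc[symmetric])

lemma dmform_expand:
  assumes "p \<in> S"
  shows "dmform h p a b c = (\<Sum>i\<in>UNIV. \<Sum>j\<in>UNIV. \<Sum>k\<in>UNIV. pd i h p $ j $ k * a $ i * b $ j * c $ k)"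
proof -
  have "dmform h p a b c = (\<Sum>i\<in>UNIV. a $ i * dmform h p (axis i 1) b c)"
    using linear_eq_sum_axis[OF linear_dmform_left[OF assms], of a b c] by simp
  also have "\<dots> = (\<Sum>i\<in>UNIV. \<Sum>j\<in>UNIV. \<Sum>k\<in>UNIV. pd i h p $ j $ k * a $ i * b $ j * c $ k)"
    by (simp add: dmform_def inner_vec_def matrix_vector_mult_def sum_distrib_left mult_ac)
  finally show ?thesis .
qed

text \<open>Lowering the upper index cancels the inverse metric and leaves the Christoffel symbols
  of the first kind, i.e. the Koszul formula for constant fields. Torsion-freeness and metric
  compatibility are read off from it.\<close>

lemma mform_chris:
  assumes p: "p \<in> S"
  shows "mform h p a (chris h p b c) = (dmform h p b a c + dmform h p c a b - dmform h p a b c) / 2"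
proof -
  define T where "T l j k = pd j h p $ l $ k + pd k h p $ l $ j - pd l h p $ j $ k" for l j k
  have lower: "(h p *v chris h p b c) $ i = (\<Sum>j\<in>UNIV. \<Sum>k\<in>UNIV. T i j k * b $ j * c $ k) / 2" for i
  proof -
    have inv: "(\<Sum>l\<in>UNIV. h p $ i $ l * matrix_inv (h p) $ l $ r) = (if i = r then 1 else 0)" for r
      using matrix_inv_mult(1)[OF invertible_h[OF p]]
      by (auto simp: vec_eq_iff matrix_matrix_mult_def mat_def)
    have "(h p *v chris h p b c) $ i =
       (\<Sum>l\<in>UNIV. \<Sum>j\<in>UNIV. \<Sum>k\<in>UNIV. \<Sum>r\<in>UNIV. h p $ i $ l * matrix_inv (h p) $ l $ r * T r j k * b $ j * c $ k / 2)"
      by (simp add: matrix_vector_mult_def chris_def christoffel_def T_def sum_distrib_left sum_distrib_right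
          sum_divide_distrib mult_ac)
    \<comment> \<open>The swaps bring the sum over \<open>l\<close> innermost, where metric times
      inverse collapses to a Kronecker delta.\<close>
    also have "\<dots> = (\<Sum>j\<in>UNIV. \<Sum>l\<in>UNIV. \<Sum>k\<in>UNIV. \<Sum>r\<in>UNIV. h p $ i $ l * matrix_inv (h p) $ l $ r * T r j k * b $ j * c $ k / 2)"
      by (rule sum.swap)
    also have "\<dots> = (\<Sum>j\<in>UNIV. \<Sum>k\<in>UNIV. \<Sum>l\<in>UNIV. \<Sum>r\<in>UNIV. h p $ i $ l * matrix_inv (h p) $ l $ r * T r j k * b $ j * c $ k / 2)"
      by (intro sum.cong refl sum.swap)
    also have "\<dots> = (\<Sum>j\<in>UNIV. \<Sum>k\<in>UNIV. \<Sum>r\<in>UNIV. \<Sum>l\<in>UNIV. h p $ i $ l * matrix_inv (h p) $ l $ r * T r j k * b $ j * c $ k / 2)"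
      by (intro sum.cong refl sum.swap)
    also have "\<dots> = (\<Sum>j\<in>UNIV. \<Sum>k\<in>UNIV. \<Sum>r\<in>UNIV. (\<Sum>l\<in>UNIV. h p $ i $ l * matrix_inv (h p) $ l $ r) * (T r j k * b $ j * c $ k / 2))"
      by (simp add: sum_distrib_right sum_divide_distrib mult.assoc)
    also have "\<dots> = (\<Sum>j\<in>UNIV. \<Sum>k\<in>UNIV. T i j k * b $ j * c $ k / 2)"
      by (simp add: inv mult_delta_left if_distrib[of "\<lambda>z. z / 2"] cong: if_cong)
    finally show ?thesis by (simp add: sum_divide_distrib)
  qed
  have "mform h p a (chris h p b c) =
      (\<Sum>i\<in>UNIV. \<Sum>j\<in>UNIV. \<Sum>k\<in>UNIV. T i j k * a $ i * b $ j * c $ k) / 2"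
    by (simp add: mform_def inner_vec_def lower sum_distrib_left sum_divide_distrib mult_ac)
  also have "(\<Sum>i\<in>UNIV. \<Sum>j\<in>UNIV. \<Sum>k\<in>UNIV. T i j k * a $ i * b $ j * c $ k) =
     (\<Sum>i\<in>UNIV. \<Sum>j\<in>UNIV. \<Sum>k\<in>UNIV. pd j h p $ i $ k * b $ j * a $ i * c $ k) +
     (\<Sum>i\<in>UNIV. \<Sum>j\<in>UNIV. \<Sum>k\<in>UNIV. pd k h p $ i $ j * c $ k * a $ i * b $ j) - dmform h p a b c"
    by (simp add: T_def dmform_expand[OF p] algebra_simps sum.distrib sum_subtractf)
  also have "(\<Sum>i\<in>UNIV. \<Sum>j\<in>UNIV. \<Sum>k\<in>UNIV. pd j h p $ i $ k * b $ j * a $ i * c $ k) = dmform h p b a c"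
    unfolding dmform_expand[OF p] by (rule sum.swap)
  also have "(\<Sum>i\<in>UNIV. \<Sum>j\<in>UNIV. \<Sum>k\<in>UNIV. pd k h p $ i $ j * c $ k * a $ i * b $ j) =
     (\<Sum>i\<in>UNIV. \<Sum>k\<in>UNIV. \<Sum>j\<in>UNIV. pd k h p $ i $ j * c $ k * a $ i * b $ j)"
    by (intro sum.cong refl sum.swap)
  also have "\<dots> = dmform h p c a b"
    unfolding dmform_expand[OF p] by (rule sum.swap)
  finally show ?thesis .
qed

lemma chris_sym:
  assumes p: "p \<in> S" shows "chris h p b c = chris h p c b"
  by (rule mform_nondegenerate[OF p]) (simp add: mform_chris[OF p] dmform_sym[OF p, of _ b c])

text \<open>When two Koszul formulas are added, symmetry of \<open>dmform\<close> cancels everything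
  except two halves of the left-hand side.\<close>

lemma metric_compatible:
  assumes p: "p \<in> S"
  shows "dmform h p c a b = mform h p (chris h p c a) b + mform h p a (chris h p c b)"
  unfolding mform_sym[OF p, of _ b] mform_chris[OF p]
  using dmform_sym[OF p, of c a b] dmform_sym[OF p, of b c a] dmform_sym[OF p, of a c b] by (simp add: field_simps)

lemma chris_differentiable:
  assumes p: "p \<in> S" shows "(\<lambda>q. chris h q a b) differentiable (at p)"
proof (rule differentiable_vec_lambda)
  fix i
  have inv: "(\<lambda>q. matrix_inv (h q) $ i $ l) differentiable (at p)" for l
    by (rule differentiable_matrix_inv[OF open_S p invertible_h h_differentiable[OF p]])
  have pd: "(\<lambda>q. pd j h q $ l $ k) differentiable (at p)" for j k l
    by (intro differentiable_vec_nth dh_differentiable p)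
  have "(\<lambda>q. christoffel h i j k q) differentiable (at p)" for j k
    unfolding christoffel_def divide_inverse
    by (intro differentiable_mult differentiable_sum finite differentiable_add differentiable_diff
        differentiable_const ballI inv pd)
  then show "(\<lambda>q. chris h q a b $ i) differentiable (at p)"
    unfolding chris_def by (auto intro!: differentiable_mult differentiable_sum)
qed

text \<open>The base map \<phi> is the identity for computations inside a chart and \<open>x\<close>
  for those along the submanifold. \<open>has_derivative_linear_family\<close> is applied once per
  vector argument.\<close>

lemma has_derivative_chris_along:
  assumes \<phi>: "(\<phi> has_derivative \<phi>') (at u)" "\<phi> u \<in> S"
    and X: "(X has_derivative X') (at u)" and Y: "(Y has_derivative Y') (at u)"
  shows "((\<lambda>q. chris h (\<phi> q) (X q) (Y q)) has_derivative
    (\<lambda>v. frechet_derivative (\<lambda>q. chris h q (X u) (Y u)) (at (\<phi> u)) (\<phi>' v)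
        + chris h (\<phi> u) (X u) (Y' v) + chris h (\<phi> u) (X' v) (Y u))) (at u)"
proof -
  have fixed: "((\<lambda>q. chris h (\<phi> q) a b) has_derivative
      (\<lambda>v. frechet_derivative (\<lambda>q. chris h q a b) (at (\<phi> u)) (\<phi>' v))) (at u)" for a b
    using diff_chain_at[OF \<phi>(1) has_derivative_frechet[OF chris_differentiable[OF \<phi>(2)]]]
    by (simp add: o_def)
  have inner: "((\<lambda>q. chris h (\<phi> q) a (Y q)) has_derivative
    (\<lambda>v. frechet_derivative (\<lambda>q. chris h q a (Y u)) (at (\<phi> u)) (\<phi>' v) + chris h (\<phi> u) a (Y' v))) (at u)" for a
    using has_derivative_linear_family[where F = "\<lambda>q b. chris h (\<phi> q) a b", OF open_UNIV UNIV_I linear_chris_right _ Y] fixed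
    unfolding frechet_derivative_eq[OF fixed] by (auto simp: differentiable_def)
  show ?thesis
    using has_derivative_linear_family[where F = "\<lambda>q a. chris h (\<phi> q) a (Y q)", OF open_UNIV UNIV_I linear_chris_left _ X] inner
    unfolding frechet_derivative_eq[OF inner] by (auto simp: differentiable_def)
qed

lemma has_derivative_mform_along:
  assumes \<phi>: "(\<phi> has_derivative \<phi>') (at u)" "\<phi> u \<in> S"
    and X: "(X has_derivative X') (at u)" and Y: "(Y has_derivative Y') (at u)"
  shows "((\<lambda>q. mform h (\<phi> q) (X q) (Y q)) has_derivative
    (\<lambda>v. dmform h (\<phi> u) (\<phi>' v) (X u) (Y u)
        + mform h (\<phi> u) (X u) (Y' v) + mform h (\<phi> u) (X' v) (Y u))) (at u)"
proof -
  have fixed: "((\<lambda>q. mform h (\<phi> q) a b) has_derivative (\<lambda>v. dmform h (\<phi> u) (\<phi>' v) a b)) (at u)" for a b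
    using diff_chain_at[OF \<phi>(1) has_derivative_frechet[OF mform_differentiable[OF \<phi>(2)]]]
    by (simp add: o_def dmform_eq[OF \<phi>(2)])
  have inner: "((\<lambda>q. mform h (\<phi> q) a (Y q)) has_derivative
    (\<lambda>v. dmform h (\<phi> u) (\<phi>' v) a (Y u) + mform h (\<phi> u) a (Y' v))) (at u)" for a
    using has_derivative_linear_family[where F = "\<lambda>q b. mform h (\<phi> q) a b", OF open_UNIV UNIV_I linear_mform_right _ Y] fixed
    unfolding frechet_derivative_eq[OF fixed] by (auto simp: differentiable_def)
  show ?thesis
    using has_derivative_linear_family[where F = "\<lambda>q a. mform h (\<phi> q) a (Y q)", OF open_UNIV UNIV_I linear_mform_left _ X] inner
    unfolding frechet_derivative_eq[OF inner] by (auto simp: differentiable_def)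
qed

lemmas has_derivative_chris = has_derivative_chris_along[OF has_derivative_ident]
lemmas has_derivative_mform = has_derivative_mform_along[OF has_derivative_ident]

text \<open>Tensoriality: second derivatives of \<open>Y\<close> cancel by symmetry, and the terms
  with the derivative of \<open>X\<close> are exactly those removed by the Lie bracket. This
  justifies inserting vectors through constant extensions.\<close>

lemma curvature_eq_curv:
  assumes p: "p \<in> S" and X: "smooth_on S X" and Y: "smooth_on S Y"
  shows "curvature h (\<lambda>_. v) X Y p = curv h p v (X p) (Y p)"
proof -
  let ?D = "\<lambda>f. frechet_derivative f (at p)"
  let ?DY = "\<lambda>q. frechet_derivative Y (at q)"
  have dX: "(X has_derivative ?D X) (at p)" and dY: "(Y has_derivative ?D Y) (at p)"
    using smooth_on_differentiable[OF X p] smooth_on_differentiable[OF Y p] by (auto intro: has_derivative_frechet)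
  have lY: "linear (?DY q)" if "q \<in> S" for q
    by (rule linear_frechet_derivative[OF smooth_on_differentiable[OF Y that]])
  have dDY: "(\<lambda>q. ?DY q a) differentiable (at p)" for a
    by (rule smooth_on_differentiable[OF smooth_on_frechet_derivative[OF Y] p])
  have "((\<lambda>q. ?DY q (X q) + chris h q (X q) (Y q)) has_derivative
    (\<lambda>v. (?D (\<lambda>q. ?DY q (X p)) v + ?DY p (?D X v)) +
       (?D (\<lambda>q. chris h q (X p) (Y p)) v + chris h p (X p) (?D Y v) + chris h p (?D X v) (Y p)))) (at p)"
    by (intro has_derivative_add has_derivative_linear_family[OF open_S p lY dDY dX]
        has_derivative_chris[OF p dX dY])
  note 1 = frechet_derivative_eq[OF this, of v]
  have "((\<lambda>q. ?DY q v + chris h q v (Y q)) has_derivative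
    (\<lambda>w. ?D (\<lambda>q. ?DY q v) w +
       (?D (\<lambda>q. chris h q v (Y p)) w + chris h p v (?D Y w) + chris h p 0 (Y p)))) (at p)"
    by (intro has_derivative_add has_derivative_frechet[OF dDY]
        has_derivative_chris[OF p has_derivative_const dY])
  note 2 = frechet_derivative_eq[OF this, of "X p"]
  have 3: "?D (\<lambda>q. ?DY q (X p)) v = ?D (\<lambda>q. ?DY q v) (X p)"
    by (rule smooth_on_symmetric_second_derivative[OF open_S p Y])
  show ?thesis
    unfolding curvature_def curv_def lie_bracket_def
    by (simp add: levi_civita_chris[abs_def] 1 2 3 linear_add[OF linear_chris_right] linear_0[OF linear_chris_left])
qed

text \<open>Metric compatibility moves the derivative from \<open>chris\<close> to its lowered form,
  at the cost of one product of Christoffel terms for each order of the directions. Pair symmetry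
  and the Gauss equation both start from this form.\<close>

lemma mform_curv:
  assumes p: "p \<in> S"
  shows "mform h p a (curv h p c d b) =
     frechet_derivative (\<lambda>q. mform h q a (chris h q d b)) (at p) c
     - frechet_derivative (\<lambda>q. mform h q a (chris h q c b)) (at p) d
     - mform h p (chris h p c a) (chris h p d b) + mform h p (chris h p d a) (chris h p c b)"
proof -
  have "frechet_derivative (\<lambda>q. mform h q a (chris h q d b)) (at p) c =
     dmform h p c a (chris h p d b) + mform h p a (frechet_derivative (\<lambda>q. chris h q d b) (at p) c)" for c d
    using frechet_derivative_eq[OF has_derivative_mform[OF p has_derivative_const
          has_derivative_frechet[OF chris_differentiable[OF p]]], of a d b c]
    by (simp add: mform_linear)
  then show ?thesis
    by (simp add: curv_def metric_compatible[OF p] mform_linear)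
qed

text \<open>By \<open>mform_chris\<close> the differentiated terms are linear in the second
  derivatives \<open>d2\<close> of the metric. Symmetry of \<open>d2\<close> in its directions and
  in its arguments then gives the claim directly, without the Bianchi identity.\<close>

lemma curv_pair_symmetry:
  assumes h: "smooth_on S h" and p: "p \<in> S"
  shows "mform h p a (curv h p c d b) = mform h p c (curv h p a b d)"
proof -
  define d2 where "d2 c d a b = a \<bullet> (frechet_derivative (\<lambda>q. frechet_derivative h (at q) d) (at p) c *v b)" for a b c d
  have dd: "((\<lambda>q. dmform h q d a b) has_derivative (\<lambda>c. d2 c d a b)) (at p)" for a b d
    unfolding dmform_def d2_def
    by (rule bounded_linear.has_derivative[OF bounded_linear_matrix_form
          has_derivative_frechet[OF dh_differentiable[OF p]]])
  have sym1: "d2 c d a b = d2 d c a b" for a b c d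
    unfolding d2_def by (simp add: smooth_on_symmetric_second_derivative[OF open_S p h, of c d])
  have sym2: "d2 c d a b = d2 c d b a" for a b c d
  proof -
    have "((\<lambda>q. dmform h q d a b) has_derivative (\<lambda>c. d2 c d b a)) (at p)"
      by (rule has_derivative_transform_within_open[OF dd open_S p]) (rule dmform_sym)
    from frechet_derivative_eq[OF this, of c] frechet_derivative_eq[OF dd, of d a b c]
    show ?thesis by simp
  qed
  have "frechet_derivative (\<lambda>q. mform h q a (chris h q d b)) (at p) c =
      (d2 c d a b + d2 c b a d - d2 c a d b) / 2" for a b c d
  proof (rule frechet_derivative_eq)
    have "((\<lambda>q. (dmform h q d a b + dmform h q b a d - dmform h q a d b) / 2) has_derivative
       (\<lambda>c. (d2 c d a b + d2 c b a d - d2 c a d b) / 2)) (at p)"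
      by (auto intro!: derivative_eq_intros dd)
    then show "((\<lambda>q. mform h q a (chris h q d b)) has_derivative
       (\<lambda>c. (d2 c d a b + d2 c b a d - d2 c a d b) / 2)) (at p)"
      by (rule has_derivative_transform_within_open[OF _ open_S p]) (simp add: mform_chris)
  qed
  note D = this
  \<comment> \<open>Torsion-freeness makes the products of Christoffel terms on both sides literally
    equal, so only second derivatives remain to be compared.\<close>
  have G: "mform h p (chris h p d a) (chris h p c b) = mform h p (chris h p b c) (chris h p a d)"
    using mform_sym[OF p, of "chris h p d a" "chris h p c b"]
    by (simp only: chris_sym[OF p, of d a] chris_sym[OF p, of c b])
  have G': "mform h p (chris h p c a) (chris h p d b) = mform h p (chris h p a c) (chris h p b d)"
    by (simp only: chris_sym[OF p, of c a] chris_sym[OF p, of d b])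
  show ?thesis
    unfolding mform_curv[OF p] D G G'
    using sym1[of c d a b] sym1[of a b c d] sym1[of c b a d] sym1[of c a d b] sym2[of a c d b]
      sym1[of d b a c] sym2[of b d a c] sym1[of d a c b]
    by argo
qed

lemma riemann_low_eq:
  assumes "p \<in> S"
  shows "riemann_low h i j k l p = mform h p (axis i 1) (curv h p (axis k 1) (axis l 1) (axis j 1))"
  unfolding riemann_low_def curvature_eq_curv[OF assms smooth_on_const smooth_on_const]
  by (simp add: mform_def inner_commute)

lemma linear_curv:
  assumes p: "p \<in> S"
  shows "linear (\<lambda>v. curv h p v x y)" "linear (\<lambda>x. curv h p v x y)" "linear (curv h p v x)"
proof -
  have D: "((\<lambda>q. chris h q a b) has_derivative frechet_derivative (\<lambda>q. chris h q a b) (at p)) (at p)" for a b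
    by (rule has_derivative_frechet[OF chris_differentiable[OF p]])
  note D0 = linear_add[OF linear_frechet_derivative[OF chris_differentiable[OF p]]]
    linear_cmul[OF linear_frechet_derivative[OF chris_differentiable[OF p]]]
  have D1: "frechet_derivative (\<lambda>q. chris h q (a + a') b) (at p) c =
     frechet_derivative (\<lambda>q. chris h q a b) (at p) c + frechet_derivative (\<lambda>q. chris h q a' b) (at p) c"
    "frechet_derivative (\<lambda>q. chris h q b (a + a')) (at p) c =
     frechet_derivative (\<lambda>q. chris h q b a) (at p) c + frechet_derivative (\<lambda>q. chris h q b a') (at p) c"
    "frechet_derivative (\<lambda>q. chris h q (r *\<^sub>R a) b) (at p) c = r *\<^sub>R frechet_derivative (\<lambda>q. chris h q a b) (at p) c"
    "frechet_derivative (\<lambda>q. chris h q b (r *\<^sub>R a)) (at p) c = r *\<^sub>R frechet_derivative (\<lambda>q. chris h q b a) (at p) c"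
    for a a' b c r
    unfolding linear_add[OF linear_chris_left] linear_add[OF linear_chris_right]
      linear_cmul[OF linear_chris_left] linear_cmul[OF linear_chris_right]
    by (rule frechet_derivative_eq; auto intro!: derivative_eq_intros D)+
  note L = linear_add[OF linear_chris_left] linear_add[OF linear_chris_right]
      linear_cmul[OF linear_chris_left] linear_cmul[OF linear_chris_right]
  show "linear (\<lambda>v. curv h p v x y)" "linear (\<lambda>x. curv h p v x y)" "linear (curv h p v x)"
    by (rule linearI; (simp only: curv_def D1); simp add: D0 L algebra_simps)+
qed

end

section \<open>The Gauss equation\<close>

locale ambient_patch =
  fixes V :: "(real^'m::finite) set" and \<eta> :: "real^'m \<Rightarrow> real^'m^'m"
    and U :: "(real^'n::finite) set" and x :: "real^'n \<Rightarrow> real^'m"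
  assumes metric: "pseudo_riemannian_metric V \<eta>"
    and patch: "submanifold_patch V \<eta> U x"
begin

lemma smooth_\<eta>: "smooth_on V \<eta>" and smooth_x: "smooth_on U x" and open_U: "open U"
  using metric patch by (auto simp: pseudo_riemannian_metric_def submanifold_patch_def)

lemma x_in_V: "u \<in> U \<Longrightarrow> x u \<in> V"
  using patch by (auto simp: submanifold_patch_def)

sublocale amb: metric_chart V \<eta>
  using metric smooth_on_differentiable[OF smooth_\<eta>]
    smooth_on_differentiable[OF smooth_on_frechet_derivative[OF smooth_\<eta>]]
  by unfold_locales (auto simp: pseudo_riemannian_metric_def)

abbreviation E :: "real^'n \<Rightarrow> real^'n \<Rightarrow> real^'m" where
  "E u \<equiv> frechet_derivative x (at u)"

abbreviation DE :: "real^'n \<Rightarrow> real^'n \<Rightarrow> real^'n \<Rightarrow> real^'m" where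
  "DE u c b \<equiv> frechet_derivative (\<lambda>q. E q b) (at u) c"

abbreviation g :: "real^'n \<Rightarrow> real^'n^'n" where "g \<equiv> induced_metric \<eta> x"

text \<open>\<open>\<nabla>\<^sub>c e\<^sub>b\<close> for the ambient connection; the indices \<open>a\<close>, \<open>b\<close>, \<open>c\<close> of the paper become constant
  vectors of the parameter domain.\<close>

definition nabla_E :: "real^'n \<Rightarrow> real^'n \<Rightarrow> real^'n \<Rightarrow> real^'m" where
  "nabla_E u c b = DE u c b + chris \<eta> (x u) (E u c) (E u b)"

text \<open>Taken as the defect between the ambient and the intrinsic connection, so that the Gauss
  equation can be proved before any projection is available. \<open>nproj_nabla_E\<close> later
  identifies it with the normal part.\<close>

definition second_form :: "real^'n \<Rightarrow> real^'n \<Rightarrow> real^'n \<Rightarrow> real^'m" where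
  "second_form u c b = nabla_E u c b - E u (chris g u c b)"

lemma x_has_derivative: "u \<in> U \<Longrightarrow> (x has_derivative E u) (at u)"
  by (rule has_derivative_frechet[OF smooth_on_differentiable[OF smooth_x]])

lemma E_has_derivative: "u \<in> U \<Longrightarrow> ((\<lambda>q. E q b) has_derivative (\<lambda>c. DE u c b)) (at u)"
  by (rule has_derivative_frechet[OF smooth_on_differentiable[OF smooth_on_frechet_derivative[OF smooth_x]]])

lemma linear_E: "u \<in> U \<Longrightarrow> linear (E u)"
  by (rule linear_frechet_derivative[OF smooth_on_differentiable[OF smooth_x]])

lemma nabla_E_sym: "u \<in> U \<Longrightarrow> nabla_E u c b = nabla_E u b c"
  unfolding nabla_E_def
  using smooth_on_symmetric_second_derivative[OF open_U _ smooth_x, of u b c]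
    amb.chris_sym[OF x_in_V, of u "E u c" "E u b"] by simp

text \<open>Metric compatibility of the ambient connection pulled back along the patch: the
  derivative of \<eta> is absorbed into the two covariant derivatives.\<close>

lemma has_derivative_mform_x:
  assumes u: "u \<in> U" and X: "(X has_derivative X') (at u)" and Y: "(Y has_derivative Y') (at u)"
  shows "((\<lambda>q. mform \<eta> (x q) (X q) (Y q)) has_derivative
    (\<lambda>c. mform \<eta> (x u) (X' c + chris \<eta> (x u) (E u c) (X u)) (Y u)
       + mform \<eta> (x u) (X u) (Y' c + chris \<eta> (x u) (E u c) (Y u)))) (at u)"
  using amb.has_derivative_mform_along[OF x_has_derivative[OF u] x_in_V[OF u] X Y]
  by (simp add: amb.metric_compatible[OF x_in_V[OF u]] mform_linear algebra_simps)

lemma nabla_E_has_derivative: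
  assumes u: "u \<in> U"
  shows "((\<lambda>q. nabla_E q d b) has_derivative
    (\<lambda>c. frechet_derivative (\<lambda>q. DE q d b) (at u) c
      + (frechet_derivative (\<lambda>q. chris \<eta> q (E u d) (E u b)) (at (x u)) (E u c)
        + chris \<eta> (x u) (E u d) (DE u c b) + chris \<eta> (x u) (DE u c d) (E u b)))) (at u)"
  unfolding nabla_E_def
  by (intro has_derivative_add amb.has_derivative_chris_along x_has_derivative x_in_V E_has_derivative u
      has_derivative_frechet smooth_on_differentiable[OF smooth_on_frechet_derivative[OF smooth_on_frechet_derivative[OF smooth_x]]])

text \<open>Coordinate fields commute, so no bracket term occurs: third derivatives of
  \<open>x\<close> cancel, and so do the Christoffel terms containing second derivatives.\<close>

lemma nabla_E_ricci_identity:
  assumes u: "u \<in> U"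
  shows "(frechet_derivative (\<lambda>q. nabla_E q d b) (at u) c + chris \<eta> (x u) (E u c) (nabla_E u d b))
       - (frechet_derivative (\<lambda>q. nabla_E q c b) (at u) d + chris \<eta> (x u) (E u d) (nabla_E u c b))
       = curv \<eta> (x u) (E u c) (E u d) (E u b)"
proof -
  have "frechet_derivative (\<lambda>q. DE q d b) (at u) c = frechet_derivative (\<lambda>q. DE q c b) (at u) d"
    by (rule smooth_on_symmetric_second_derivative[OF open_U u smooth_on_frechet_derivative[OF smooth_x]])
  moreover have "DE u c d = DE u d c"
    by (rule smooth_on_symmetric_second_derivative[OF open_U u smooth_x])
  ultimately show ?thesis
    unfolding frechet_derivative_eq[OF nabla_E_has_derivative[OF u]] curv_def
    by (simp add: nabla_E_def linear_add[OF linear_chris_right])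
qed

section \<open>The induced metric and its connection\<close>

lemma E_mform_has_derivative:
  assumes u: "u \<in> U"
  shows "((\<lambda>q. mform \<eta> (x q) (E q a) (E q b)) has_derivative
    (\<lambda>c. mform \<eta> (x u) (nabla_E u c a) (E u b) + mform \<eta> (x u) (E u a) (nabla_E u c b))) (at u)"
  using has_derivative_mform_x[OF u E_has_derivative[OF u] E_has_derivative[OF u]] by (simp add: nabla_E_def)

lemma g_component: "g u $ a $ b = mform \<eta> (x u) (E u (axis a 1)) (E u (axis b 1))"
  by (simp add: induced_metric_def mform_def)

lemma g_has_derivative:
  assumes u: "u \<in> U"
  shows "(g has_derivative (\<lambda>c. \<chi> a b. mform \<eta> (x u) (nabla_E u c (axis a 1)) (E u (axis b 1))
     + mform \<eta> (x u) (E u (axis a 1)) (nabla_E u c (axis b 1)))) (at u)"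
  by (intro has_derivative_vec_lambda) (simp add: g_component E_mform_has_derivative u)

lemma nabla_E_differentiable: "u \<in> U \<Longrightarrow> (\<lambda>q. nabla_E q d b) differentiable (at u)"
  using nabla_E_has_derivative unfolding differentiable_def by blast

lemma mform_x_differentiable:
  assumes "u \<in> U" "X differentiable (at u)" "Y differentiable (at u)"
  shows "(\<lambda>q. mform \<eta> (x q) (X q) (Y q)) differentiable (at u)"
  using has_derivative_mform_x[OF assms(1) has_derivative_frechet[OF assms(2)] has_derivative_frechet[OF assms(3)]]
  by (auto simp: differentiable_def)

lemma E_differentiable: "u \<in> U \<Longrightarrow> (\<lambda>q. E q b) differentiable (at u)"
  using E_has_derivative by (auto simp: differentiable_def)

text \<open>The first derivative of \<open>g\<close> consists of pairings of \<open>E\<close> with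
  \<open>nabla_E\<close>, which are themselves differentiable; this supplies the second
  derivative.\<close>

sublocale ind: metric_chart U g
proof
  fix u assume u: "u \<in> U"
  show "transpose (g u) = g u"
    using amb.mform_sym[OF x_in_V[OF u]] by (simp add: vec_eq_iff transpose_def g_component)
  show "invertible (g u)" using patch u by (simp add: submanifold_patch_def)
  show "g differentiable (at u)" using g_has_derivative[OF u] by (auto simp: differentiable_def)
  fix v
  show "(\<lambda>q. frechet_derivative g (at q) v) differentiable (at u)"
  proof (rule differentiable_transform_within_open[OF _ open_U u])
    show "(\<lambda>q. \<chi> a b. mform \<eta> (x q) (nabla_E q v (axis a 1)) (E q (axis b 1))
     + mform \<eta> (x q) (E q (axis a 1)) (nabla_E q v (axis b 1))) differentiable (at u)"
      by (intro differentiable_vec_lambda) (simp add: mform_x_differentiable E_differentiable nabla_E_differentiable u)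
  qed (simp add: frechet_derivative_eq[OF g_has_derivative])
qed (rule open_U)

lemma mform_g:
  assumes u: "u \<in> U" shows "mform g u a b = mform \<eta> (x u) (E u a) (E u b)"
proof -
  have "mform g u a b = (\<Sum>i\<in>UNIV. a $ i * (\<Sum>j\<in>UNIV. b $ j * mform \<eta> (x u) (E u (axis i 1)) (E u (axis j 1))))"
    by (simp add: mform_def[of g] inner_vec_def matrix_vector_mult_def g_component mult.commute)
  also have "\<dots> = mform \<eta> (x u) (E u a) (E u b)"
  proof -
    have "mform \<eta> (x u) v (E u b) = (\<Sum>j\<in>UNIV. b $ j * mform \<eta> (x u) v (E u (axis j 1)))" for v
      by (subst linear_eq_sum_axis[OF linear_E[OF u], of b]) (simp add: mform_linear)
    then show ?thesis
      by (subst linear_eq_sum_axis[OF linear_E[OF u], of a]) (simp add: mform_linear)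
  qed
  finally show ?thesis .
qed

lemma dmform_g:
  assumes u: "u \<in> U"
  shows "dmform g u c a b = mform \<eta> (x u) (nabla_E u c a) (E u b) + mform \<eta> (x u) (E u a) (nabla_E u c b)"
proof -
  have "((\<lambda>q. mform g q a b) has_derivative
    (\<lambda>c. mform \<eta> (x u) (nabla_E u c a) (E u b) + mform \<eta> (x u) (E u a) (nabla_E u c b))) (at u)"
    by (rule has_derivative_transform_within_open[OF E_mform_has_derivative[OF u] open_U u]) (simp add: mform_g)
  from frechet_derivative_eq[OF this] show ?thesis by (simp add: ind.dmform_eq[OF u])
qed

text \<open>The intrinsic connection is the tangential part of the ambient one. In the Koszul
  formula for \<open>g\<close> every derivative splits into two pairings; symmetry of
  \<open>nabla_E\<close> cancels four of the six, and the other two coincide.\<close>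

lemma mform_chris_g:
  assumes u: "u \<in> U"
  shows "mform g u a (chris g u c b) = mform \<eta> (x u) (E u a) (nabla_E u c b)"
  unfolding ind.mform_chris[OF u] dmform_g[OF u]
  by (simp add: nabla_E_sym[OF u, of b c] nabla_E_sym[OF u, of a c] nabla_E_sym[OF u, of a b]
      amb.mform_sym[OF x_in_V[OF u], of "nabla_E u b a" "E u c"])

lemma second_form_normal:
  assumes u: "u \<in> U" shows "mform \<eta> (x u) (E u a) (second_form u c b) = 0"
  using mform_chris_g[OF u, of a c b] by (simp add: second_form_def mform_linear mform_g[OF u])

lemma second_form_sym: "u \<in> U \<Longrightarrow> second_form u c b = second_form u b c"
  unfolding second_form_def using nabla_E_sym[of u c b] ind.chris_sym[of u c b] by simp

lemma mform_nabla_E: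
  assumes u: "u \<in> U"
  shows "mform \<eta> (x u) (nabla_E u c a) (nabla_E u d b) =
     mform \<eta> (x u) (second_form u c a) (second_form u d b) + mform g u (chris g u c a) (chris g u d b)"
proof -
  have "nabla_E u c a = second_form u c a + E u (chris g u c a)" for c a by (simp add: second_form_def)
  then show ?thesis
    using second_form_normal[OF u, of "chris g u c a" d b] second_form_normal[OF u, of "chris g u d b" c a]
      amb.mform_sym[OF x_in_V[OF u], of "second_form u c a" "E u (chris g u d b)"]
    by (simp add: mform_linear mform_g[OF u])
qed

text \<open>By \<open>mform_chris_g\<close> the lowered Christoffel symbols of \<open>g\<close> are
  pairings of \<open>E u a\<close> with \<open>nabla_E\<close>. Differentiating them produces the
  ambient commutator and products of two \<open>nabla_E\<close>. The products of
  \<open>chris g\<close> in \<open>mform_curv\<close> subtract the tangential part of the latter,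
  leaving second fundamental forms; the second form itself is never differentiated.\<close>

lemma gauss_equation:
  assumes u: "u \<in> U"
  shows "mform g u a (curv g u c d b) = mform \<eta> (x u) (E u a) (curv \<eta> (x u) (E u c) (E u d) (E u b))
    + mform \<eta> (x u) (second_form u c a) (second_form u d b) - mform \<eta> (x u) (second_form u d a) (second_form u c b)"
proof -
  have "((\<lambda>q. mform g q a (chris g q d b)) has_derivative
    (\<lambda>c. mform \<eta> (x u) (nabla_E u c a) (nabla_E u d b) + mform \<eta> (x u) (E u a)
       (frechet_derivative (\<lambda>q. nabla_E q d b) (at u) c + chris \<eta> (x u) (E u c) (nabla_E u d b)))) (at u)" for d b
    by (rule has_derivative_transform_within_open[OF
          has_derivative_mform_x[OF u E_has_derivative[OF u] has_derivative_frechet[OF nabla_E_differentiable[OF u]], folded nabla_E_def]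
           open_U u])
      (simp add: mform_chris_g)
  from frechet_derivative_eq[OF this] show ?thesis
    unfolding ind.mform_curv[OF u] nabla_E_ricci_identity[OF u, symmetric]
    by (simp add: mform_nabla_E[OF u] mform_linear)
qed

lemma ricci_eq:
  assumes u: "u \<in> U" and X: "smooth_on U X" and Y: "smooth_on U Y"
  shows "ricci g X Y u = (\<Sum>a\<in>UNIV. \<Sum>b\<in>UNIV. matrix_inv (g u) $ a $ b *
     mform g u (axis b 1) (curv g u (axis a 1) (X u) (Y u)))"
proof -
  have "w $ a = (\<Sum>b\<in>UNIV. matrix_inv (g u) $ a $ b * mform g u (axis b 1) w)" for w a
  proof -
    have "matrix_inv (g u) *v (g u *v w) = w"
      using matrix_inv_mult(2)[OF ind.invertible_h[OF u]] by (simp add: matrix_vector_mul_assoc)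
    then have "w $ a = (matrix_inv (g u) *v (g u *v w)) $ a" by simp
    also have "\<dots> = (\<Sum>b\<in>UNIV. matrix_inv (g u) $ a $ b * mform g u (axis b 1) w)"
      by (simp add: matrix_vector_mult_def[of "matrix_inv _"] mform_def inner_axis')
    finally show ?thesis .
  qed
  note components = this
  have "ricci g X Y u = (\<Sum>a\<in>UNIV. curv g u (axis a 1) (X u) (Y u) $ a)"
    by (simp add: ricci_def trace_def matrix_def ind.curvature_eq_curv[OF u X Y])
  then show ?thesis by (subst (asm) components)
qed

end

section \<open>The normal projection and its derivative\<close>

lemma sum_swap_pairs:
  "(\<Sum>i\<in>A. \<Sum>j\<in>B. \<Sum>k\<in>C. \<Sum>l\<in>D. f i j k l) = (\<Sum>k\<in>C. \<Sum>l\<in>D. \<Sum>i\<in>A. \<Sum>j\<in>B. f i j k l)"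
proof -
  have "(\<Sum>i\<in>A. \<Sum>j\<in>B. \<Sum>k\<in>C. \<Sum>l\<in>D. f i j k l) = (\<Sum>i\<in>A. \<Sum>k\<in>C. \<Sum>l\<in>D. \<Sum>j\<in>B. f i j k l)"
    by (intro sum.cong refl, subst sum.swap, intro sum.cong refl sum.swap)
  also have "\<dots> = (\<Sum>k\<in>C. \<Sum>l\<in>D. \<Sum>i\<in>A. \<Sum>j\<in>B. f i j k l)"
    by (subst sum.swap, intro sum.cong refl sum.swap)
  finally show ?thesis .
qed

lemma bilinear_expand:
  fixes f :: "real^'a::finite \<Rightarrow> real^'b::finite \<Rightarrow> real"
  assumes "\<And>y. linear (\<lambda>x. f x y)" "\<And>x. linear (f x)"
  shows "f v w = (\<Sum>i\<in>UNIV. \<Sum>j\<in>UNIV. v $ i * w $ j * f (axis i 1) (axis j 1))"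
proof -
  have "f v w = (\<Sum>i\<in>UNIV. v $ i * f (axis i 1) w)"
    by (subst linear_eq_sum_axis[OF assms(1)]) simp
  also have "\<dots> = (\<Sum>i\<in>UNIV. v $ i * (\<Sum>j\<in>UNIV. w $ j * f (axis i 1) (axis j 1)))"
    by (subst linear_eq_sum_axis[OF assms(2)]) simp
  finally show ?thesis by (simp add: sum_distrib_left mult.assoc)
qed

lemma matrix_inv_symmetric:
  fixes A :: "real^'k^'k::finite"
  assumes "invertible A" "transpose A = A"
  shows "matrix_inv A $ i $ j = matrix_inv A $ j $ i"
proof -
  have "transpose (matrix_inv A) ** A = mat 1"
    using arg_cong[OF matrix_inv_mult(1)[OF assms(1)], of transpose] assms(2)
    by (simp add: matrix_transpose_mul)
  then have "transpose (matrix_inv A) ** (A ** matrix_inv A) = matrix_inv A"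
    by (simp add: matrix_mul_assoc)
  then have "transpose (matrix_inv A) = matrix_inv A"
    by (simp add: matrix_inv_mult(1)[OF assms(1)])
  then have "transpose (matrix_inv A) $ j $ i = matrix_inv A $ j $ i" by (simp only:)
  then show ?thesis by (simp add: transpose_def)
qed

lemma matrix_entry_inner: "A $ i $ j = axis i 1 \<bullet> (A *v axis j 1)"
  for A :: "real^'a::finite^'b::finite"
  by (simp add: inner_axis' matrix_vector_mul_component inner_axis)

lemma inner_matrix_axis: "v \<bullet> (A *v axis j 1) = (\<Sum>i\<in>UNIV. v $ i * A $ i $ j)"
  for A :: "real^'a::finite^'b::finite"
  by (simp add: inner_vec_def matrix_vector_mult_basis column_def)

lemma sum_contract:
  fixes G :: "'k \<Rightarrow> 'l \<Rightarrow> 'i \<Rightarrow> 'j \<Rightarrow> real"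
  shows "(\<Sum>i\<in>A. \<Sum>j\<in>B. (\<Sum>k\<in>C. \<Sum>l\<in>L. G k l i j) * v i * w j) =
     (\<Sum>k\<in>C. \<Sum>l\<in>L. \<Sum>i\<in>A. \<Sum>j\<in>B. G k l i j * v i * w j)"
  unfolding sum_distrib_right by (rule sum_swap_pairs)

lemma sum_product_common_index:
  fixes a :: "'k \<Rightarrow> 'l \<Rightarrow> 'a::comm_semiring_0"
  shows "(\<Sum>i\<in>I. \<Sum>k\<in>K. \<Sum>l\<in>L. a k l * b i l) = (\<Sum>l\<in>L. (\<Sum>k\<in>K. a k l) * (\<Sum>i\<in>I. b i l))"
proof -
  have "(\<Sum>i\<in>I. \<Sum>k\<in>K. \<Sum>l\<in>L. a k l * b i l) = (\<Sum>i\<in>I. \<Sum>l\<in>L. \<Sum>k\<in>K. a k l * b i l)"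
    by (rule sum.cong[OF refl], rule sum.swap)
  also have "\<dots> = (\<Sum>l\<in>L. \<Sum>i\<in>I. \<Sum>k\<in>K. a k l * b i l)" by (rule sum.swap)
  finally show ?thesis by (simp add: sum_distrib_left sum_distrib_right)
qed

lemma linear_mult_sum:
  fixes F :: "'l \<Rightarrow> 'v::real_vector \<Rightarrow> real"
  assumes "\<And>l. l \<in> L \<Longrightarrow> linear (F l)"
  shows "linear (\<lambda>w. \<Sum>l\<in>L. c l * F l w)" "linear (\<lambda>w. \<Sum>l\<in>L. F l w * c l)"
  by (rule linearI; simp add: linear_add[OF assms] linear_cmul[OF assms] ring_distribs sum.distrib
      sum_distrib_left mult_ac)+

text \<open>What the bracket contributes to the geometry is condensed into \<open>D_eq\<close>; from
  here on \<open>D\<close> is any tensor of this form.\<close>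

locale projected_patch = ambient_patch V \<eta> U x
  for V :: "(real^'m::finite) set" and \<eta> :: "real^'m \<Rightarrow> real^'m^'m"
    and U :: "(real^'n::finite) set" and x :: "real^'n \<Rightarrow> real^'m" +
  fixes D :: "real^'n \<Rightarrow> real^'m^'m"
  assumes D_eq: "\<And>u i j. u \<in> U \<Longrightarrow> D u $ i $ j = (\<Sum>a\<in>UNIV. \<Sum>b\<in>UNIV.
      matrix_inv (induced_metric \<eta> x u) $ a $ b * pd a x u $ i * pd b x u $ j)"
begin

abbreviation e :: "real^'n \<Rightarrow> 'n \<Rightarrow> real^'m" where "e u a \<equiv> E u (axis a 1)"

abbreviation ginv :: "real^'n \<Rightarrow> 'n \<Rightarrow> 'n \<Rightarrow> real" where "ginv u a b \<equiv> matrix_inv (g u) $ a $ b"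

lemma ginv_sym: "u \<in> U \<Longrightarrow> ginv u a b = ginv u b a"
  by (rule matrix_inv_symmetric[OF ind.invertible_h ind.transpose_h])

text \<open>The components \<open>w\<^sup>a\<close> of the tangential projection \<open>D(v) = w\<^sup>a e\<^sub>a\<close>.\<close>

definition tcomp :: "real^'n \<Rightarrow> real^'m \<Rightarrow> real^'n" where
  "tcomp u v = matrix_inv (g u) *v (\<chi> b. mform \<eta> (x u) (e u b) v)"

lemma tcomp_nth: "tcomp u v $ a = (\<Sum>b\<in>UNIV. ginv u a b * mform \<eta> (x u) (e u b) v)"
  by (simp add: tcomp_def matrix_vector_mult_def)

lemma linear_tcomp: "linear (tcomp u)"
  by (rule linearI)
    (simp_all add: vec_eq_iff tcomp_nth mform_linear algebra_simps sum.distrib sum_distrib_left)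

lemma tcomp_E:
  assumes u: "u \<in> U" shows "tcomp u (E u w) = w"
proof -
  have "(\<chi> b. mform \<eta> (x u) (e u b) (E u w)) = g u *v w"
    by (simp add: vec_eq_iff mform_g[OF u, symmetric]) (simp add: mform_def inner_axis')
  then show ?thesis
    by (simp add: tcomp_def matrix_vector_mul_assoc matrix_inv_mult(2)[OF ind.invertible_h[OF u]])
qed

text \<open>Since \<open>D\<close> factors through the parameter domain, every direction of a hat
  derivative has the form \<open>E u w\<close>, and \<open>tangent_components\<close> is never taken
  of a vector for which it is unspecified.\<close>

lemma D_map_eq:
  assumes u: "u \<in> U" shows "D_map \<eta> x D u v = E u (tcomp u v)"
proof (subst vec_eq_iff, rule allI)
  fix i
  have "D_map \<eta> x D u v $ i = (\<Sum>j\<in>UNIV. D u $ i $ j * (\<eta> (x u) *v v) $ j)"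
    by (simp add: D_map_def matrix_vector_mult_def sum_distrib_left mult.assoc)
  also have "\<dots> = (\<Sum>j\<in>UNIV. \<Sum>a\<in>UNIV. \<Sum>b\<in>UNIV. ginv u a b * e u a $ i * e u b $ j * (\<eta> (x u) *v v) $ j)"
    by (simp add: D_eq[OF u] sum_distrib_right)
  also have "\<dots> = (\<Sum>a\<in>UNIV. \<Sum>j\<in>UNIV. \<Sum>b\<in>UNIV. ginv u a b * e u a $ i * e u b $ j * (\<eta> (x u) *v v) $ j)"
    by (rule sum.swap)
  also have "\<dots> = (\<Sum>a\<in>UNIV. \<Sum>b\<in>UNIV. \<Sum>j\<in>UNIV. ginv u a b * e u a $ i * e u b $ j * (\<eta> (x u) *v v) $ j)"
    by (intro sum.cong refl sum.swap)
  also have "\<dots> = (\<Sum>a\<in>UNIV. tcomp u v $ a * e u a $ i)"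
    by (simp add: tcomp_nth mform_def inner_vec_def sum_distrib_left sum_distrib_right mult_ac)
  also have "\<dots> = E u (tcomp u v) $ i"
    by (subst linear_eq_sum_axis[OF linear_E[OF u], of "tcomp u v"]) simp
  finally show "D_map \<eta> x D u v $ i = E u (tcomp u v) $ i" .
qed

lemma tangent_components_E:
  assumes u: "u \<in> U" shows "tangent_components x u (E u w) = w"
proof -
  have "(\<Sum>a\<in>UNIV. w' $ a *\<^sub>R pd a x u) = E u w'" for w'
    by (rule linear_eq_sum_axis[OF linear_E[OF u], symmetric])
  moreover have "inj (E u)" using patch u by (simp add: submanifold_patch_def)
  ultimately show ?thesis unfolding tangent_components_def by (auto dest: injD)
qed

definition nproj :: "real^'n \<Rightarrow> real^'m \<Rightarrow> real^'m" where
  "nproj u v = v - E u (tcomp u v)"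

lemma nproj_E: "u \<in> U \<Longrightarrow> nproj u (E u w) = 0"
  by (simp add: nproj_def tcomp_E)

lemma nproj_nabla_E:
  assumes u: "u \<in> U" shows "nproj u (nabla_E u c b) = second_form u c b"
proof -
  have "tcomp u (second_form u c b) = 0"
    by (simp add: vec_eq_iff tcomp_nth second_form_normal[OF u])
  then have "tcomp u (nabla_E u c b) = chris g u c b"
    using tcomp_E[OF u] by (simp add: second_form_def linear_diff[OF linear_tcomp])
  then show ?thesis by (simp add: nproj_def second_form_def)
qed

lemma mform_E_tcomp_expand:
  assumes u: "u \<in> U"
  shows "mform \<eta> (x u) v (E u (tcomp u w)) = (\<Sum>a\<in>UNIV. \<Sum>b\<in>UNIV.
     ginv u a b * mform \<eta> (x u) (e u a) v * mform \<eta> (x u) (e u b) w)"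
proof -
  have "mform \<eta> (x u) v (E u (tcomp u w)) = (\<Sum>a\<in>UNIV. tcomp u w $ a * mform \<eta> (x u) v (e u a))"
    by (subst linear_eq_sum_axis[OF linear_E[OF u], of "tcomp u w"]) (simp add: mform_linear)
  then show ?thesis
    by (simp add: tcomp_nth sum_distrib_left sum_distrib_right amb.mform_sym[OF x_in_V[OF u], of v] mult_ac)
qed

text \<open>Self-adjointness of the projection is symmetry of the inverse metric
  \<open>ginv\<close>. All symmetry statements about \<Pi> reduce to it.\<close>

lemma mform_nproj_sym:
  assumes u: "u \<in> U" shows "mform \<eta> (x u) v (nproj u w) = mform \<eta> (x u) w (nproj u v)"
proof -
  have "mform \<eta> (x u) v (E u (tcomp u w)) = mform \<eta> (x u) w (E u (tcomp u v))"
    unfolding mform_E_tcomp_expand[OF u]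
    by (subst sum.swap) (simp add: ginv_sym[OF u] mult_ac)
  then show ?thesis
    by (simp add: nproj_def mform_linear amb.mform_sym[OF x_in_V[OF u], of v w])
qed

section \<open>The tensor \<Pi>: symmetry and differentiability\<close>

abbreviation Piu :: "real^'n \<Rightarrow> real^'m^'m" where "Piu \<equiv> Pi_up \<eta> x D"
abbreviation Pil :: "real^'n \<Rightarrow> real^'m^'m" where "Pil \<equiv> Pi_low \<eta> x D"

lemma Pi_mixed_mult:
  assumes u: "u \<in> U" shows "Pi_mixed \<eta> x D u *v v = nproj u v"
proof -
  have "linear (\<lambda>X. X - D_map \<eta> x D u X)"
    unfolding D_map_eq[OF u]
    by (rule linearI) (simp_all add: linear_add[OF linear_tcomp] linear_add[OF linear_E[OF u]]
        linear_cmul[OF linear_tcomp] linear_cmul[OF linear_E[OF u]] algebra_simps)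
  then show ?thesis by (simp add: Pi_mixed_def matrix_works nproj_def D_map_eq[OF u])
qed

lemma Pil_mult: "u \<in> U \<Longrightarrow> Pil u *v v = \<eta> (x u) *v nproj u v"
  by (simp add: Pi_low_def Pi_mixed_mult flip: matrix_vector_mul_assoc)

lemma Piu_mult: "u \<in> U \<Longrightarrow> Piu u *v (\<eta> (x u) *v v) = nproj u v"
  by (simp add: Pi_up_def matrix_inv_mult(2)[OF amb.invertible_h[OF x_in_V]] Pi_mixed_mult
      matrix_vector_mul_assoc flip: matrix_mul_assoc)

lemma Pil_inner: "u \<in> U \<Longrightarrow> v \<bullet> (Pil u *v w) = mform \<eta> (x u) v (nproj u w)"
  by (simp add: Pil_mult mform_def)

lemma Piu_inner:
  assumes u: "u \<in> U"
  shows "(\<eta> (x u) *v v) \<bullet> (Piu u *v (\<eta> (x u) *v w)) = mform \<eta> (x u) w (nproj u v)"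
  unfolding Piu_mult[OF u] mform_nproj_sym[OF u, of w]
    amb.mform_sym[OF x_in_V[OF u], of v "nproj u w"]
  by (simp add: mform_def inner_commute)

lemma \<eta>_surj:
  assumes u: "u \<in> U" obtains w where "v = \<eta> (x u) *v w"
proof
  show "v = \<eta> (x u) *v (matrix_inv (\<eta> (x u)) *v v)"
    by (simp add: matrix_vector_mul_assoc matrix_inv_mult(1)[OF amb.invertible_h[OF x_in_V[OF u]]])
qed

lemma Pil_sym:
  assumes u: "u \<in> U" shows "Pil u $ i $ j = Pil u $ j $ i"
  unfolding matrix_entry_inner Pil_inner[OF u] by (rule mform_nproj_sym[OF u])

text \<open>Every covector is \<eta> applied to a vector, so it suffices to test on lowered vectors,
  where \<open>Piu\<close> is \<open>nproj\<close>.\<close>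

lemma Piu_inner_sym:
  assumes u: "u \<in> U" shows "v \<bullet> (Piu u *v w) = w \<bullet> (Piu u *v v)"
proof -
  obtain v' w' where "v = \<eta> (x u) *v v'" "w = \<eta> (x u) *v w'" by (metis \<eta>_surj[OF u])
  then show ?thesis by (simp add: Piu_inner[OF u] mform_nproj_sym[OF u, of v'])
qed

lemma Piu_sym:
  assumes u: "u \<in> U" shows "Piu u $ i $ j = Piu u $ j $ i"
  unfolding matrix_entry_inner by (rule Piu_inner_sym[OF u])

lemma ginv_differentiable: "u \<in> U \<Longrightarrow> (\<lambda>q. ginv q a b) differentiable (at u)"
  by (rule differentiable_matrix_inv[OF open_U _ ind.invertible_h ind.h_differentiable])

text \<open>Only existence of the derivative is wanted. It follows from an explicit formula for the
  entries; their derivatives are never computed from that formula.\<close>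

lemma Pil_differentiable:
  assumes u: "u \<in> U" shows "Pil differentiable (at u)"
proof (intro differentiable_vec_lambda)
  fix i j
  show "(\<lambda>q. Pil q $ i $ j) differentiable (at u)"
  proof (rule differentiable_transform_within_open[OF _ open_U u])
    show "(\<lambda>q. mform \<eta> (x q) (axis i 1) (axis j 1) - (\<Sum>a\<in>UNIV. \<Sum>b\<in>UNIV.
       ginv q a b * mform \<eta> (x q) (e q a) (axis i 1) * mform \<eta> (x q) (e q b) (axis j 1))) differentiable (at u)"
      by (intro differentiable_diff differentiable_sum differentiable_mult finite ballI
          ginv_differentiable mform_x_differentiable E_differentiable differentiable_const u)
  qed (simp add: matrix_entry_inner[of "Pil _"] Pil_inner nproj_def mform_linear mform_E_tcomp_expand)
qed

lemma Piu_eq: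
  assumes u: "u \<in> U" shows "Piu u $ i $ j = matrix_inv (\<eta> (x u)) $ i $ j
      - (\<Sum>a\<in>UNIV. \<Sum>b\<in>UNIV. ginv u a b * e u a $ i * e u b $ j)"
proof -
  let ?w = "matrix_inv (\<eta> (x u)) *v axis j 1"
  have w: "\<eta> (x u) *v ?w = axis j 1"
    by (simp add: matrix_vector_mul_assoc matrix_inv_mult(1)[OF amb.invertible_h[OF x_in_V[OF u]]])
  have "Piu u $ i $ j = nproj u ?w $ i"
    using Piu_mult[OF u, of ?w] by (simp add: matrix_entry_inner[of "Piu u"] w inner_axis')
  also have "\<dots> = matrix_inv (\<eta> (x u)) $ i $ j - E u (tcomp u ?w) $ i"
    by (simp add: nproj_def matrix_vector_mul_component inner_axis)
  also have "E u (tcomp u ?w) $ i = (\<Sum>a\<in>UNIV. tcomp u ?w $ a * e u a $ i)"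
    by (subst linear_eq_sum_axis[OF linear_E[OF u], of "tcomp u ?w"]) simp
  also have "\<dots> = (\<Sum>a\<in>UNIV. \<Sum>b\<in>UNIV. ginv u a b * e u a $ i * e u b $ j)"
    by (simp add: tcomp_nth mform_def w inner_axis sum_distrib_left sum_distrib_right mult_ac)
  finally show ?thesis .
qed

lemma Piu_differentiable:
  assumes u: "u \<in> U" shows "Piu differentiable (at u)"
proof (intro differentiable_vec_lambda)
  fix i j
  have \<eta>: "(\<lambda>q. \<eta> (x q)) differentiable (at u)"
    using diff_chain_at[OF x_has_derivative[OF u] has_derivative_frechet[OF amb.h_differentiable[OF x_in_V[OF u]]]]
    by (auto simp: differentiable_def o_def)
  show "(\<lambda>q. Piu q $ i $ j) differentiable (at u)"
  proof (rule differentiable_transform_within_open[OF _ open_U u])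
    show "(\<lambda>q. matrix_inv (\<eta> (x q)) $ i $ j - (\<Sum>a\<in>UNIV. \<Sum>b\<in>UNIV.
       ginv q a b * e q a $ i * e q b $ j)) differentiable (at u)"
      by (intro differentiable_diff differentiable_sum differentiable_mult finite ballI
          ginv_differentiable differentiable_vec_nth E_differentiable u
          differentiable_matrix_inv[OF open_U u amb.invertible_h[OF x_in_V] \<eta>])
  qed (simp add: Piu_eq)
qed

section \<open>Covariant derivatives of \<Pi> in tangent directions\<close>

definition nabla_Piu :: "real^'n \<Rightarrow> real^'n \<Rightarrow> 'm \<Rightarrow> 'm \<Rightarrow> real" where
  "nabla_Piu u w i j = nabla_up \<eta> x u (E u w) Piu i j"

definition nabla_Pil :: "real^'n \<Rightarrow> real^'n \<Rightarrow> 'm \<Rightarrow> 'm \<Rightarrow> real" where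
  "nabla_Pil u w i j = nabla_low \<eta> x u (E u w) Pil i j"

lemma chris_axis: "chris h p v (axis k 1) $ i = (\<Sum>l\<in>UNIV. v $ l * christoffel h i l k p)"
  by (simp add: chris_def axis_def if_distrib cong: if_cong) (simp add: mult.commute)

lemma nabla_Piu_eq:
  assumes u: "u \<in> U"
  shows "nabla_Piu u w i j = frechet_derivative Piu (at u) w $ i $ j
     + (\<Sum>k\<in>UNIV. chris \<eta> (x u) (E u w) (axis k 1) $ i * Piu u $ k $ j)
     + (\<Sum>k\<in>UNIV. chris \<eta> (x u) (E u w) (axis k 1) $ j * Piu u $ i $ k)"
  unfolding nabla_Piu_def nabla_up_def tangent_components_E[OF u] chris_axis
  by (subst sum.swap) (simp add: sum_distrib_right ring_distribs sum.distrib mult.assoc)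

lemma nabla_Pil_eq:
  assumes u: "u \<in> U"
  shows "nabla_Pil u w i j = frechet_derivative Pil (at u) w $ i $ j
     - (\<Sum>k\<in>UNIV. chris \<eta> (x u) (E u w) (axis i 1) $ k * Pil u $ k $ j)
     - (\<Sum>k\<in>UNIV. chris \<eta> (x u) (E u w) (axis j 1) $ k * Pil u $ i $ k)"
  unfolding nabla_Pil_def nabla_low_def tangent_components_E[OF u] chris_axis
  by (subst sum.swap) (simp add: sum_distrib_right ring_distribs sum.distrib mult.assoc)

lemma frechet_derivative_symmetric_matrix:
  fixes T :: "real^'n \<Rightarrow> real^'m^'m"
  assumes u: "u \<in> U" and T: "T differentiable (at u)" and symT: "\<And>q i j. q \<in> U \<Longrightarrow> T q $ i $ j = T q $ j $ i"
  shows "frechet_derivative T (at u) w $ i $ j = frechet_derivative T (at u) w $ j $ i"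
proof -
  have "frechet_derivative (\<lambda>q. T q $ i $ j) (at u) = frechet_derivative (\<lambda>q. T q $ j $ i) (at u)"
    by (rule frechet_derivative_transform_within_open[OF
          differentiable_vec_nth[OF differentiable_vec_nth[OF T]] open_U u]) (rule symT)
  then show ?thesis
    by (simp add: frechet_derivative_vec_nth[OF T, symmetric]
        frechet_derivative_vec_nth[OF differentiable_vec_nth[OF T], symmetric])
qed

lemma nabla_Piu_sym:
  assumes u: "u \<in> U" shows "nabla_Piu u w i j = nabla_Piu u w j i"
  using frechet_derivative_symmetric_matrix[OF u Piu_differentiable[OF u] Piu_sym, of w i j]
  by (simp add: nabla_Piu_eq[OF u] Piu_sym[OF u, of _ j] Piu_sym[OF u, of i])

lemma nabla_Pil_sym:
  assumes u: "u \<in> U" shows "nabla_Pil u w i j = nabla_Pil u w j i"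
  using frechet_derivative_symmetric_matrix[OF u Pil_differentiable[OF u] Pil_sym, of w i j]
  by (simp add: nabla_Pil_eq[OF u] Pil_sym[OF u, of _ j] Pil_sym[OF u, of i])

text \<open>Linearity in the parameter direction allows derivative indices to be summed through
  \<open>tcomp\<close>.\<close>

lemma linear_nabla_Piu:
  assumes u: "u \<in> U" shows "linear (\<lambda>w. nabla_Piu u w i j)"
  by (rule linearI) (simp_all add: nabla_Piu_eq[OF u]
      linear_add[OF linear_frechet_derivative[OF Piu_differentiable[OF u]]]
      linear_cmul[OF linear_frechet_derivative[OF Piu_differentiable[OF u]]]
      linear_add[OF linear_E[OF u]] linear_cmul[OF linear_E[OF u]]
      linear_add[OF linear_chris_left] linear_cmul[OF linear_chris_left]
      ring_distribs sum.distrib sum_distrib_left mult.assoc)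

lemma linear_nabla_Pil:
  assumes u: "u \<in> U" shows "linear (\<lambda>w. nabla_Pil u w i j)"
  by (rule linearI) (simp_all add: nabla_Pil_eq[OF u]
      linear_add[OF linear_frechet_derivative[OF Pil_differentiable[OF u]]]
      linear_cmul[OF linear_frechet_derivative[OF Pil_differentiable[OF u]]]
      linear_add[OF linear_E[OF u]] linear_cmul[OF linear_E[OF u]]
      linear_add[OF linear_chris_left] linear_cmul[OF linear_chris_left]
      ring_distribs sum.distrib sum_distrib_left mult.assoc)

lemma chris_expand: "chris h p v w $ i = (\<Sum>k\<in>UNIV. w $ k * chris h p v (axis k 1) $ i)"
  by (subst linear_eq_sum_axis[OF linear_chris_right]) simp

text \<open>Differentiate \<open>\<Pi>(e\<^sub>a, \<cdot>) = 0\<close>; no derivative of \<open>g\<^sup>a\<^sup>b\<close> has to be computed.\<close>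

lemma nabla_Pil_tangent:
  assumes u: "u \<in> U"
  shows "(\<Sum>i\<in>UNIV. E u a $ i * nabla_Pil u w i l) = - mform \<eta> (x u) (axis l 1) (second_form u w a)"
proof -
  have zero: "E q a \<bullet> (Pil q *v v) = 0" if "q \<in> U" for q v
    using mform_nproj_sym[OF that, of "E q a" v] by (simp add: Pil_inner[OF that] nproj_E[OF that] mform_linear)
  let ?P = "\<lambda>q. Pil q *v axis l 1"
  have 1: "((\<lambda>q. E q a \<bullet> ?P q) has_derivative
     (\<lambda>w. E u a \<bullet> (frechet_derivative Pil (at u) w *v axis l 1) + DE u w a \<bullet> ?P u)) (at u)"
    by (intro has_derivative_inner E_has_derivative[OF u]
        bounded_linear.has_derivative[OF bounded_linear_matrix_vector_mult_left has_derivative_frechet[OF Pil_differentiable[OF u]]])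
  have 2: "((\<lambda>q. E q a \<bullet> ?P q) has_derivative (\<lambda>w. 0)) (at u)"
    by (rule has_derivative_transform_within_open[OF has_derivative_const open_U u]) (simp add: zero)
  have "E u a \<bullet> (frechet_derivative Pil (at u) w *v axis l 1) + DE u w a \<bullet> ?P u = 0"
    using frechet_derivative_eq[OF 1, of w] frechet_derivative_eq[OF 2, of w] by (simp only:)
  then have d: "(\<Sum>i\<in>UNIV. E u a $ i * frechet_derivative Pil (at u) w $ i $ l) = - (DE u w a \<bullet> ?P u)"
    by (simp add: inner_matrix_axis)
  let ?G = "chris \<eta> (x u) (E u w)"
  have c1: "(\<Sum>i\<in>UNIV. E u a $ i * (\<Sum>k\<in>UNIV. ?G (axis i 1) $ k * Pil u $ k $ l)) = ?G (E u a) \<bullet> ?P u"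
  proof -
    have "(\<Sum>i\<in>UNIV. E u a $ i * (\<Sum>k\<in>UNIV. ?G (axis i 1) $ k * Pil u $ k $ l)) =
      (\<Sum>k\<in>UNIV. \<Sum>i\<in>UNIV. E u a $ i * ?G (axis i 1) $ k * Pil u $ k $ l)"
      by (subst sum.swap) (simp add: sum_distrib_left mult.assoc)
    then show ?thesis by (simp add: inner_matrix_axis chris_expand[of _ _ _ "E u a"] sum_distrib_right)
  qed
  \<comment> \<open>This connection term acts on the free index \<open>l\<close>; \<Pi> is still
    paired with the tangent vector \<open>E u a\<close>, so it vanishes.\<close>
  have c2: "(\<Sum>i\<in>UNIV. E u a $ i * (\<Sum>k\<in>UNIV. ?G (axis l 1) $ k * Pil u $ i $ k)) = 0"
  proof -
    have "(\<Sum>i\<in>UNIV. E u a $ i * (\<Sum>k\<in>UNIV. ?G (axis l 1) $ k * Pil u $ i $ k)) =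
      (\<Sum>k\<in>UNIV. ?G (axis l 1) $ k * (\<Sum>i\<in>UNIV. E u a $ i * Pil u $ i $ k))"
      unfolding sum_distrib_left by (subst sum.swap) (simp add: mult_ac)
    then show ?thesis by (simp add: zero[OF u] flip: inner_matrix_axis)
  qed
  have "(\<Sum>i\<in>UNIV. E u a $ i * nabla_Pil u w i l) = - (DE u w a \<bullet> ?P u) - ?G (E u a) \<bullet> ?P u"
    unfolding nabla_Pil_eq[OF u] right_diff_distrib sum_subtractf c1 c2 d by simp
  also have "\<dots> = - (nabla_E u w a \<bullet> ?P u)" by (simp add: nabla_E_def inner_add_left)
  also have "nabla_E u w a \<bullet> ?P u = mform \<eta> (x u) (axis l 1) (second_form u w a)"
    by (simp add: Pil_inner[OF u] mform_nproj_sym[OF u, of "nabla_E u w a"] nproj_nabla_E[OF u])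
  finally show ?thesis .
qed

text \<open>The upper-index counterpart of \<open>nabla_Pil_tangent\<close>. The tangent vector must
  now be lowered with \<eta> along the patch, so the product rule also differentiates the metric;
  the extra term is cancelled by the connection term \<open>c1\<close>.\<close>

lemma nabla_Piu_tangent:
  assumes u: "u \<in> U"
  shows "(\<Sum>i\<in>UNIV. (\<eta> (x u) *v E u a) $ i * nabla_Piu u w i l) = - (second_form u w a $ l)"
proof -
  have zero: "(\<eta> (x q) *v E q a) \<bullet> (Piu q *v v) = 0" if "q \<in> U" for q v
    by (simp add: Piu_inner_sym[OF that, of _ v] Piu_mult[OF that] nproj_E[OF that])
  let ?P = "\<lambda>q. Piu q *v axis l 1"
  let ?G = "chris \<eta> (x u) (E u w)"
  \<comment> \<open>Derivative of the covector obtained by lowering \<open>E q a\<close>: the first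
    summand is the one cancelled by \<open>c1\<close>, the second is the lowered
    \<open>nabla_E\<close>.\<close>
  let ?a' = "\<lambda>w. \<chi> i. mform \<eta> (x u) (chris \<eta> (x u) (E u w) (axis i 1)) (E u a) + mform \<eta> (x u) (axis i 1) (nabla_E u w a)"
  have nth: "(\<eta> (x q) *v v) $ i = mform \<eta> (x q) (axis i 1) v" for q v i
    by (simp add: mform_def inner_axis')
  have a': "((\<lambda>q. \<eta> (x q) *v E q a) has_derivative ?a') (at u)"
    by (rule has_derivative_vec_lambda)
      (use has_derivative_mform_x[OF u has_derivative_const E_has_derivative[OF u]] in \<open>simp add: nth nabla_E_def\<close>)
  have 1: "((\<lambda>q. (\<eta> (x q) *v E q a) \<bullet> ?P q) has_derivative
     (\<lambda>w. (\<eta> (x u) *v E u a) \<bullet> (frechet_derivative Piu (at u) w *v axis l 1) + ?a' w \<bullet> ?P u)) (at u)"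
    by (intro has_derivative_inner a'
        bounded_linear.has_derivative[OF bounded_linear_matrix_vector_mult_left has_derivative_frechet[OF Piu_differentiable[OF u]]])
  have 2: "((\<lambda>q. (\<eta> (x q) *v E q a) \<bullet> ?P q) has_derivative (\<lambda>w. 0)) (at u)"
    by (rule has_derivative_transform_within_open[OF has_derivative_const open_U u]) (simp add: zero)
  have "(\<eta> (x u) *v E u a) \<bullet> (frechet_derivative Piu (at u) w *v axis l 1) + ?a' w \<bullet> ?P u = 0"
    using frechet_derivative_eq[OF 1, of w] frechet_derivative_eq[OF 2, of w] by (simp only:)
  then have d: "(\<Sum>i\<in>UNIV. (\<eta> (x u) *v E u a) $ i * frechet_derivative Piu (at u) w $ i $ l) = - (?a' w \<bullet> ?P u)"
    by (simp add: inner_matrix_axis)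
  have c1: "(\<Sum>i\<in>UNIV. (\<eta> (x u) *v E u a) $ i * (\<Sum>k\<in>UNIV. ?G (axis k 1) $ i * Piu u $ k $ l)) =
      (\<chi> k. mform \<eta> (x u) (?G (axis k 1)) (E u a)) \<bullet> ?P u"
  proof -
    have "(\<Sum>i\<in>UNIV. (\<eta> (x u) *v E u a) $ i * (\<Sum>k\<in>UNIV. ?G (axis k 1) $ i * Piu u $ k $ l)) =
      (\<Sum>k\<in>UNIV. (\<Sum>i\<in>UNIV. ?G (axis k 1) $ i * (\<eta> (x u) *v E u a) $ i) * Piu u $ k $ l)"
      unfolding sum_distrib_left sum_distrib_right by (subst sum.swap) (simp add: mult_ac)
    then show ?thesis
      by (subst inner_matrix_axis) (simp add: mform_def inner_vec_def)
  qed
  have c2: "(\<Sum>i\<in>UNIV. (\<eta> (x u) *v E u a) $ i * (\<Sum>k\<in>UNIV. ?G (axis k 1) $ l * Piu u $ i $ k)) = 0"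
  proof -
    have "(\<Sum>i\<in>UNIV. (\<eta> (x u) *v E u a) $ i * (\<Sum>k\<in>UNIV. ?G (axis k 1) $ l * Piu u $ i $ k)) =
      (\<Sum>k\<in>UNIV. ?G (axis k 1) $ l * (\<Sum>i\<in>UNIV. (\<eta> (x u) *v E u a) $ i * Piu u $ i $ k))"
      unfolding sum_distrib_left by (subst sum.swap) (simp add: mult_ac)
    then show ?thesis by (simp add: zero[OF u] flip: inner_matrix_axis)
  qed
  have "?a' w = (\<chi> k. mform \<eta> (x u) (?G (axis k 1)) (E u a)) + \<eta> (x u) *v nabla_E u w a"
    by (simp add: vec_eq_iff nth)
  then have "(\<Sum>i\<in>UNIV. (\<eta> (x u) *v E u a) $ i * nabla_Piu u w i l) = - ((\<eta> (x u) *v nabla_E u w a) \<bullet> ?P u)"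
    unfolding nabla_Piu_eq[OF u] distrib_left sum.distrib c1 c2 d by (simp add: inner_add_left)
  also have "(\<eta> (x u) *v nabla_E u w a) \<bullet> ?P u = second_form u w a $ l"
    by (simp add: Piu_inner_sym[OF u, of _ "axis l 1"] Piu_mult[OF u] nproj_nabla_E[OF u] inner_axis')
  finally show ?thesis .
qed

text \<open>Expanding \<open>tcomp\<close> in the inverse metric turns the sum over the ambient
  index \<open>k\<close> into a contraction of that index with \<open>t d\<close>. For
  \<open>z k = axis k 1\<close> this is the lowered tangent vector \<open>e u d\<close>; for a
  raised axis it is \<open>e u d\<close> itself.\<close>

lemma sum_tcomp:
  fixes F :: "'m \<Rightarrow> real^'n \<Rightarrow> real"
  assumes F: "\<And>k. linear (F k)" and z: "\<And>d k. mform \<eta> (x u) (e u d) (z k) = t d $ k"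
  shows "(\<Sum>k\<in>UNIV. F k (tcomp u (z k))) =
     (\<Sum>c\<in>UNIV. \<Sum>d\<in>UNIV. ginv u c d * (\<Sum>k\<in>UNIV. t d $ k * F k (axis c 1)))"
proof -
  have "F k (tcomp u (z k)) = (\<Sum>c\<in>UNIV. \<Sum>d\<in>UNIV. ginv u c d * (t d $ k * F k (axis c 1)))" for k
    by (subst linear_eq_sum_axis[OF F]) (simp add: tcomp_nth z sum_distrib_right mult.assoc)
  then have "(\<Sum>k\<in>UNIV. F k (tcomp u (z k))) =
    (\<Sum>k\<in>UNIV. \<Sum>c\<in>UNIV. \<Sum>d\<in>UNIV. ginv u c d * (t d $ k * F k (axis c 1)))" by simp
  also have "\<dots> = (\<Sum>c\<in>UNIV. \<Sum>k\<in>UNIV. \<Sum>d\<in>UNIV. ginv u c d * (t d $ k * F k (axis c 1)))"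
    by (rule sum.swap)
  also have "\<dots> = (\<Sum>c\<in>UNIV. \<Sum>d\<in>UNIV. \<Sum>k\<in>UNIV. ginv u c d * (t d $ k * F k (axis c 1)))"
    by (intro sum.cong refl sum.swap)
  finally show ?thesis by (simp add: sum_distrib_left)
qed

section \<open>Hat derivatives as derivatives in parameter directions\<close>

definition raised_axis :: "real^'n \<Rightarrow> 'm \<Rightarrow> real^'m" where
  "raised_axis u k = (\<chi> l. matrix_inv (\<eta> (x u)) $ k $ l)"

lemma mform_raised_axis:
  assumes u: "u \<in> U" shows "mform \<eta> (x u) v (raised_axis u k) = v $ k"
proof -
  have "raised_axis u k = matrix_inv (\<eta> (x u)) *v axis k 1"
    using matrix_inv_symmetric[OF amb.invertible_h amb.transpose_h, OF x_in_V x_in_V, OF u u]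
    by (simp add: raised_axis_def vec_eq_iff matrix_vector_mult_basis column_def)
  then show ?thesis
    by (simp add: mform_def matrix_vector_mul_assoc matrix_inv_mult(1)[OF amb.invertible_h[OF x_in_V[OF u]]] inner_axis)
qed

lemma mform_axis:
  assumes u: "u \<in> U" shows "mform \<eta> (x u) v (axis k 1) = (\<eta> (x u) *v v) $ k"
  by (subst amb.mform_sym[OF x_in_V[OF u]]) (simp add: mform_def inner_axis')

lemma hat_up_eq: "u \<in> U \<Longrightarrow> hat_up \<eta> x D Piu k i j u = nabla_Piu u (tcomp u (axis k 1)) i j"
  by (simp add: hat_up_def D_map_eq nabla_Piu_def)

lemma hat_low_eq: "u \<in> U \<Longrightarrow> hat_low \<eta> x D Pil k i j u = nabla_Pil u (tcomp u (axis k 1)) i j"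
  by (simp add: hat_low_def D_map_eq nabla_Pil_def)

lemma hatr_up_eq:
  assumes u: "u \<in> U" shows "hatr_up \<eta> x D Piu k i j u = nabla_Piu u (tcomp u (raised_axis u k)) i j"
proof -
  have "linear (\<lambda>v. nabla_Piu u (tcomp u v) i j)"
    using linear_compose[OF linear_tcomp linear_nabla_Piu[OF u]] by (simp add: o_def)
  from linear_eq_sum_axis[OF this, of "raised_axis u k"] show ?thesis
    by (simp add: hatr_up_def hat_up_eq[OF u]) (simp add: raised_axis_def)
qed

lemma hatr_low_eq:
  assumes u: "u \<in> U" shows "hatr_low \<eta> x D Pil k i j u = nabla_Pil u (tcomp u (raised_axis u k)) i j"
proof -
  have "linear (\<lambda>v. nabla_Pil u (tcomp u v) i j)"
    using linear_compose[OF linear_tcomp linear_nabla_Pil[OF u]] by (simp add: o_def)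
  from linear_eq_sum_axis[OF this, of "raised_axis u k"] show ?thesis
    by (simp add: hatr_low_def hat_low_eq[OF u]) (simp add: raised_axis_def)
qed

text \<open>The projection fixes tangent vectors, so contracting a derivative index with
  \<open>E u w\<close> gives the derivative in direction \<open>w\<close>.\<close>

lemma sum_tcomp_E:
  fixes F :: "real^'n \<Rightarrow> real"
  assumes u: "u \<in> U" and F: "linear F"
  shows "(\<Sum>j\<in>UNIV. F (tcomp u (axis j 1)) * E u w $ j) = F w"
proof -
  have "linear (\<lambda>v. F (tcomp u v))" using linear_compose[OF linear_tcomp F] by (simp add: o_def)
  from linear_eq_sum_axis[OF this, of "E u w"] show ?thesis by (simp add: tcomp_E[OF u] mult.commute)
qed

lemma sum_mform: "(\<Sum>l\<in>UNIV. w $ l * mform \<eta> p (axis l 1) v) = mform \<eta> p w v"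
  using linear_eq_sum_axis[OF linear_mform_left[of \<eta> p v], of w] by simp

definition trace_second_form :: "real^'n \<Rightarrow> real^'m" where
  "trace_second_form u = (\<Sum>c\<in>UNIV. \<Sum>d\<in>UNIV. ginv u c d *\<^sub>R second_form u (axis c 1) (axis d 1))"

lemma hat_up_trace:
  assumes u: "u \<in> U" shows "(\<Sum>k\<in>UNIV. hat_up \<eta> x D Piu k k l u) = - trace_second_form u $ l"
  unfolding hat_up_eq[OF u]
  by (subst sum_tcomp[OF linear_nabla_Piu[OF u] mform_axis[OF u]])
    (simp add: nabla_Piu_tangent[OF u] trace_second_form_def sum_negf)

lemma hatr_low_trace:
  assumes u: "u \<in> U"
  shows "(\<Sum>k\<in>UNIV. hatr_low \<eta> x D Pil k k l u) = - mform \<eta> (x u) (axis l 1) (trace_second_form u)"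
  unfolding hatr_low_eq[OF u]
  by (subst sum_tcomp[OF linear_nabla_Pil[OF u] mform_raised_axis[OF u]])
    (simp add: nabla_Pil_tangent[OF u] trace_second_form_def mform_linear sum_negf)

lemma hat_low_tangent:
  assumes u: "u \<in> U"
  shows "(\<Sum>i\<in>UNIV. \<Sum>j\<in>UNIV. hat_low \<eta> x D Pil j i l u * E u w $ i * E u z $ j) =
     - mform \<eta> (x u) (axis l 1) (second_form u z w)"
proof -
  have "(\<Sum>i\<in>UNIV. \<Sum>j\<in>UNIV. hat_low \<eta> x D Pil j i l u * E u w $ i * E u z $ j) =
    (\<Sum>i\<in>UNIV. E u w $ i * (\<Sum>j\<in>UNIV. nabla_Pil u (tcomp u (axis j 1)) i l * E u z $ j))"
    by (simp add: hat_low_eq[OF u] sum_distrib_left mult_ac)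
  then show ?thesis by (simp add: sum_tcomp_E[OF u linear_nabla_Pil[OF u]] nabla_Pil_tangent[OF u])
qed

section \<open>The three terms of the Ricci formula\<close>

lemma D_contract:
  assumes u: "u \<in> U"
  shows "(\<Sum>i\<in>UNIV. \<Sum>j\<in>UNIV. D u $ i $ j * F i j) =
     (\<Sum>a\<in>UNIV. \<Sum>b\<in>UNIV. ginv u a b * (\<Sum>i\<in>UNIV. \<Sum>j\<in>UNIV. F i j * e u a $ i * e u b $ j))"
proof -
  have "(\<Sum>i\<in>UNIV. \<Sum>j\<in>UNIV. D u $ i $ j * F i j) =
     (\<Sum>i\<in>UNIV. \<Sum>j\<in>UNIV. \<Sum>a\<in>UNIV. \<Sum>b\<in>UNIV. ginv u a b * (F i j * e u a $ i * e u b $ j))"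
    by (simp add: D_eq[OF u] sum_distrib_left sum_distrib_right mult_ac)
  then show ?thesis by (subst (asm) sum_swap_pairs) (simp add: sum_distrib_left)
qed

lemma curvature_term:
  assumes u: "u \<in> U"
  shows "(\<Sum>i\<in>UNIV. \<Sum>j\<in>UNIV. (\<Sum>k\<in>UNIV. \<Sum>l\<in>UNIV. D u $ k $ l * riemann_low \<eta> k i l j (x u))
      * E u w $ i * E u z $ j) =
    (\<Sum>a\<in>UNIV. \<Sum>b\<in>UNIV. ginv u a b * mform \<eta> (x u) (e u b) (curv \<eta> (x u) (e u a) (E u w) (E u z)))"
proof -
  note xV = x_in_V[OF u]
  let ?R = "\<lambda>k l v w. mform \<eta> (x u) k (curv \<eta> (x u) l w v)"
  have lin: "linear (\<lambda>k. ?R k l v w)" "linear (\<lambda>l. ?R k l v w)" "linear (\<lambda>v. ?R k l v w)" "linear (\<lambda>w. ?R k l v w)"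
    for k l v w
    using linear_mform_left linear_compose[OF amb.linear_curv(1)[OF xV] linear_mform_right]
      linear_compose[OF amb.linear_curv(2)[OF xV] linear_mform_right]
      linear_compose[OF amb.linear_curv(3)[OF xV] linear_mform_right]
    by (auto simp: o_def)
  have "(\<Sum>i\<in>UNIV. \<Sum>j\<in>UNIV. (\<Sum>k\<in>UNIV. \<Sum>l\<in>UNIV. D u $ k $ l * riemann_low \<eta> k i l j (x u))
      * E u w $ i * E u z $ j) =
     (\<Sum>k\<in>UNIV. \<Sum>l\<in>UNIV. D u $ k $ l * ?R (axis k 1) (axis l 1) (E u w) (E u z))"
    unfolding sum_contract
    by (subst bilinear_expand[where f = "?R _ _" and v = "E u w" and w = "E u z", OF lin(3,4)])
      (simp add: amb.riemann_low_eq[OF xV] sum_distrib_left mult_ac)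
  also have "\<dots> = (\<Sum>a\<in>UNIV. \<Sum>b\<in>UNIV. ginv u a b * ?R (e u a) (e u b) (E u w) (E u z))"
    unfolding D_contract[OF u]
    by (subst (2) bilinear_expand[where f = "\<lambda>k l. ?R k l (E u w) (E u z)", OF lin(1,2)])
      (simp add: mult_ac)
  \<comment> \<open>So far \<open>E u w\<close> is the vector acted on by the curvature and
    \<open>E u z\<close> the second direction. Pair symmetry exchanges these roles and the two
    traced slots, as in the definition of Ricci curvature.\<close>
  also have "\<dots> = (\<Sum>a\<in>UNIV. \<Sum>b\<in>UNIV. ginv u a b * mform \<eta> (x u) (e u b) (curv \<eta> (x u) (e u a) (E u w) (E u z)))"
    by (subst amb.curv_pair_symmetry[OF smooth_\<eta> xV]) (rule refl)
  finally show ?thesis .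
qed

lemma mean_curvature_term:
  assumes u: "u \<in> U"
  shows "(\<Sum>i\<in>UNIV. \<Sum>j\<in>UNIV.
      (\<Sum>k\<in>UNIV. \<Sum>l\<in>UNIV. hat_up \<eta> x D Piu k k l u * hat_low \<eta> x D Pil j i l u) * E u w $ i * E u z $ j) =
    mform \<eta> (x u) (trace_second_form u) (second_form u w z)"
proof -
  have "(\<Sum>i\<in>UNIV. \<Sum>j\<in>UNIV.
      (\<Sum>k\<in>UNIV. \<Sum>l\<in>UNIV. hat_up \<eta> x D Piu k k l u * hat_low \<eta> x D Pil j i l u) * E u w $ i * E u z $ j) =
     (\<Sum>k\<in>UNIV. \<Sum>l\<in>UNIV. hat_up \<eta> x D Piu k k l u *
        (\<Sum>i\<in>UNIV. \<Sum>j\<in>UNIV. hat_low \<eta> x D Pil j i l u * E u w $ i * E u z $ j))"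
    unfolding sum_contract by (simp add: sum_distrib_left mult.assoc)
  also have "\<dots> = (\<Sum>l\<in>UNIV. (\<Sum>k\<in>UNIV. hat_up \<eta> x D Piu k k l u) * - mform \<eta> (x u) (axis l 1) (second_form u z w))"
    unfolding hat_low_tangent[OF u] sum_distrib_right by (rule sum.swap)
  also have "\<dots> = mform \<eta> (x u) (trace_second_form u) (second_form u w z)"
    by (simp add: hat_up_trace[OF u] sum_mform second_form_sym[OF u, of z w])
  finally show ?thesis .
qed

text \<open>The tangent vectors reach the second index of each derivative of \<Pi>, so symmetry of
  these derivatives first moves them to the position covered by the tangent lemmas. The remaining
  index \<open>l\<close> pairs the two second fundamental forms.\<close>

lemma second_form_square_term:
  assumes u: "u \<in> U"
  shows "(\<Sum>i\<in>UNIV. \<Sum>j\<in>UNIV.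
      (\<Sum>k\<in>UNIV. \<Sum>l\<in>UNIV. hat_low \<eta> x D Pil k l i u * hat_up \<eta> x D Piu j l k u) * E u w $ i * E u z $ j) =
    (\<Sum>a\<in>UNIV. \<Sum>b\<in>UNIV. ginv u a b * mform \<eta> (x u) (second_form u w (axis b 1)) (second_form u (axis a 1) z))"
proof -
  have low: "(\<Sum>i\<in>UNIV. nabla_Pil u c l i * E u w $ i) = - mform \<eta> (x u) (axis l 1) (second_form u c w)" for c l
    using nabla_Pil_tangent[OF u, of w c l] by (simp add: nabla_Pil_sym[OF u, of c l] mult.commute)
  have up: "(\<Sum>k\<in>UNIV. (\<eta> (x u) *v e u d) $ k * nabla_Piu u z l k) = - second_form u z (axis d 1) $ l" for d l
    using nabla_Piu_tangent[OF u, of "axis d 1" z l] by (simp add: nabla_Piu_sym[OF u, of z l])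
  have "(\<Sum>i\<in>UNIV. \<Sum>j\<in>UNIV.
      (\<Sum>k\<in>UNIV. \<Sum>l\<in>UNIV. hat_low \<eta> x D Pil k l i u * hat_up \<eta> x D Piu j l k u) * E u w $ i * E u z $ j) =
    (\<Sum>k\<in>UNIV. \<Sum>l\<in>UNIV. (\<Sum>i\<in>UNIV. nabla_Pil u (tcomp u (axis k 1)) l i * E u w $ i) *
       (\<Sum>j\<in>UNIV. nabla_Piu u (tcomp u (axis j 1)) l k * E u z $ j))"
    unfolding sum_contract by (simp add: sum_product hat_up_eq[OF u] hat_low_eq[OF u] mult_ac)
  also have "\<dots> = (\<Sum>k\<in>UNIV. \<Sum>l\<in>UNIV. (\<Sum>i\<in>UNIV. nabla_Pil u (tcomp u (axis k 1)) l i * E u w $ i) * nabla_Piu u z l k)"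
    by (simp only: sum_tcomp_E[OF u linear_nabla_Piu[OF u]])
  \<comment> \<open>The index \<open>k\<close> is the derivative index of the first factor and a
    tensor index of the second. Keeping both factors inside \<open>F k\<close> lets
    \<open>sum_tcomp\<close> insert the lowered \<open>e u d\<close> into the second.\<close>
  also have "\<dots> = (\<Sum>c\<in>UNIV. \<Sum>d\<in>UNIV. ginv u c d * (\<Sum>k\<in>UNIV. (\<eta> (x u) *v e u d) $ k *
       (\<Sum>l\<in>UNIV. (\<Sum>i\<in>UNIV. nabla_Pil u (axis c 1) l i * E u w $ i) * nabla_Piu u z l k)))"
    by (rule sum_tcomp[where F = "\<lambda>k c. \<Sum>l\<in>UNIV. (\<Sum>i\<in>UNIV. nabla_Pil u c l i * E u w $ i) * nabla_Piu u z l k"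
          and z = "\<lambda>k. axis k 1"]) (intro linear_mult_sum linear_nabla_Pil u mform_axis)+
  also have "\<dots> = (\<Sum>c\<in>UNIV. \<Sum>d\<in>UNIV. ginv u c d * mform \<eta> (x u) (second_form u z (axis d 1)) (second_form u (axis c 1) w))"
  proof (intro sum.cong refl arg_cong[where f = "(*) _"])
    fix c d
    have "(\<Sum>k\<in>UNIV. (\<eta> (x u) *v e u d) $ k *
       (\<Sum>l\<in>UNIV. (\<Sum>i\<in>UNIV. nabla_Pil u (axis c 1) l i * E u w $ i) * nabla_Piu u z l k)) =
       (\<Sum>l\<in>UNIV. (\<Sum>i\<in>UNIV. nabla_Pil u (axis c 1) l i * E u w $ i) * (\<Sum>k\<in>UNIV. (\<eta> (x u) *v e u d) $ k * nabla_Piu u z l k))"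
      unfolding sum_distrib_left[of _ _ UNIV] by (subst sum.swap) (simp add: mult_ac)
    also have "\<dots> = mform \<eta> (x u) (second_form u z (axis d 1)) (second_form u (axis c 1) w)"
      using sum_mform[of "second_form u z (axis d 1)" "x u" "second_form u (axis c 1) w"]
      unfolding low up by (simp add: mult.commute)
    finally show "(\<Sum>k\<in>UNIV. (\<eta> (x u) *v e u d) $ k *
       (\<Sum>l\<in>UNIV. (\<Sum>i\<in>UNIV. nabla_Pil u (axis c 1) l i * E u w $ i) * nabla_Piu u z l k)) =
       mform \<eta> (x u) (second_form u z (axis d 1)) (second_form u (axis c 1) w)" .
  qed
  also have "\<dots> = (\<Sum>a\<in>UNIV. \<Sum>b\<in>UNIV. ginv u b a * mform \<eta> (x u) (second_form u z (axis a 1)) (second_form u (axis b 1) w))"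
    by (rule sum.swap)
  also have "\<dots> = (\<Sum>a\<in>UNIV. \<Sum>b\<in>UNIV. ginv u a b * mform \<eta> (x u) (second_form u w (axis b 1)) (second_form u (axis a 1) z))"
    by (intro sum.cong refl)
      (metis ginv_sym[OF u] second_form_sym[OF u] amb.mform_sym[OF x_in_V[OF u]])
  finally show ?thesis .
qed

section \<open>Ricci and scalar curvature\<close>

lemma ricci_gauss:
  assumes u: "u \<in> U" and X: "smooth_on U X" and Y: "smooth_on U Y"
  shows "ricci g X Y u =
    (\<Sum>a\<in>UNIV. \<Sum>b\<in>UNIV. ginv u a b * mform \<eta> (x u) (e u b) (curv \<eta> (x u) (e u a) (E u (X u)) (E u (Y u))))
    + mform \<eta> (x u) (trace_second_form u) (second_form u (X u) (Y u))
    - (\<Sum>a\<in>UNIV. \<Sum>b\<in>UNIV. ginv u a b * mform \<eta> (x u) (second_form u (X u) (axis b 1)) (second_form u (axis a 1) (Y u)))"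
  unfolding ricci_eq[OF assms] gauss_equation[OF u]
  by (simp add: trace_second_form_def mform_linear ring_distribs sum.distrib sum_subtractf)

lemma ricci_formula:
  assumes u: "u \<in> U" and X: "smooth_on U X" and Y: "smooth_on U Y"
  shows "ricci g X Y u =
               (\<Sum>i\<in>UNIV. \<Sum>j\<in>UNIV.
                  ((\<Sum>k\<in>UNIV. \<Sum>l\<in>UNIV. D u $ k $ l * riemann_low \<eta> k i l j (x u))
                   + (\<Sum>k\<in>UNIV. \<Sum>l\<in>UNIV. hat_up \<eta> x D Piu k k l u * hat_low \<eta> x D Pil j i l u)
                   - (\<Sum>k\<in>UNIV. \<Sum>l\<in>UNIV. hat_low \<eta> x D Pil k l i u * hat_up \<eta> x D Piu j l k u))
                  * E u (X u) $ i * E u (Y u) $ j)"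
  unfolding ricci_gauss[OF assms] distrib_right left_diff_distrib sum.distrib sum_subtractf
    curvature_term[OF u] mean_curvature_term[OF u] second_form_square_term[OF u] by (rule refl)

text \<open>The derivative index of each factor is contracted with a tensor index of the other, so
  \<open>sum_tcomp\<close> is used twice: for \<open>i\<close>, where the raised axis yields an
  unlowered \<open>e u d\<close>, and for \<open>k\<close>, where the tangent vector comes
  lowered.\<close>

lemma second_form_norm_term:
  assumes u: "u \<in> U"
  shows "(\<Sum>i\<in>UNIV. \<Sum>k\<in>UNIV. \<Sum>l\<in>UNIV. hat_low \<eta> x D Pil k i l u * hatr_up \<eta> x D Piu i k l u) =
    (\<Sum>c\<in>UNIV. \<Sum>d\<in>UNIV. ginv u c d * (\<Sum>a\<in>UNIV. \<Sum>b\<in>UNIV. ginv u a b *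
       mform \<eta> (x u) (second_form u (axis c 1) (axis b 1)) (second_form u (axis a 1) (axis d 1))))"
proof -
  have "(\<Sum>i\<in>UNIV. \<Sum>k\<in>UNIV. \<Sum>l\<in>UNIV. hat_low \<eta> x D Pil k i l u * hatr_up \<eta> x D Piu i k l u) =
    (\<Sum>i\<in>UNIV. \<Sum>k\<in>UNIV. \<Sum>l\<in>UNIV. nabla_Pil u (tcomp u (axis k 1)) i l * nabla_Piu u (tcomp u (raised_axis u i)) k l)"
    by (simp only: hat_low_eq[OF u] hatr_up_eq[OF u])
  also have "\<dots> = (\<Sum>c\<in>UNIV. \<Sum>d\<in>UNIV. ginv u c d * (\<Sum>i\<in>UNIV. e u d $ i *
      (\<Sum>k\<in>UNIV. \<Sum>l\<in>UNIV. nabla_Pil u (tcomp u (axis k 1)) i l * nabla_Piu u (axis c 1) k l)))"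
    by (rule sum_tcomp[where F = "\<lambda>i c. \<Sum>k\<in>UNIV. \<Sum>l\<in>UNIV. nabla_Pil u (tcomp u (axis k 1)) i l * nabla_Piu u c k l"
          and z = "raised_axis u"]) (intro linear_compose_sum linear_mult_sum ballI linear_nabla_Piu u mform_raised_axis)+
  also have "\<dots> = (\<Sum>c\<in>UNIV. \<Sum>d\<in>UNIV. ginv u c d * (\<Sum>a\<in>UNIV. \<Sum>b\<in>UNIV. ginv u a b *
       mform \<eta> (x u) (second_form u (axis c 1) (axis b 1)) (second_form u (axis a 1) (axis d 1))))"
  proof (intro sum.cong refl arg_cong[where f = "(*) _"])
    fix c d
    let ?N = "\<lambda>w l. \<Sum>i\<in>UNIV. e u d $ i * nabla_Pil u w i l"
    let ?P = "nabla_Piu u (axis c 1)"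
    have "(\<Sum>i\<in>UNIV. e u d $ i * (\<Sum>k\<in>UNIV. \<Sum>l\<in>UNIV. nabla_Pil u (tcomp u (axis k 1)) i l * ?P k l)) =
      (\<Sum>i\<in>UNIV. \<Sum>k\<in>UNIV. \<Sum>l\<in>UNIV. e u d $ i * nabla_Pil u (tcomp u (axis k 1)) i l * ?P k l)"
      by (simp add: sum_distrib_left mult.assoc)
    also have "\<dots> = (\<Sum>k\<in>UNIV. \<Sum>i\<in>UNIV. \<Sum>l\<in>UNIV. e u d $ i * nabla_Pil u (tcomp u (axis k 1)) i l * ?P k l)"
      by (rule sum.swap)
    also have "\<dots> = (\<Sum>k\<in>UNIV. \<Sum>l\<in>UNIV. \<Sum>i\<in>UNIV. e u d $ i * nabla_Pil u (tcomp u (axis k 1)) i l * ?P k l)"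
      by (intro sum.cong refl sum.swap)
    also have "\<dots> = (\<Sum>k\<in>UNIV. \<Sum>l\<in>UNIV. ?N (tcomp u (axis k 1)) l * ?P k l)"
      by (simp add: sum_distrib_right)
    also have "\<dots> = (\<Sum>a\<in>UNIV. \<Sum>b\<in>UNIV. ginv u a b * (\<Sum>k\<in>UNIV. (\<eta> (x u) *v e u b) $ k *
        (\<Sum>l\<in>UNIV. ?N (axis a 1) l * ?P k l)))"
      by (rule sum_tcomp[where F = "\<lambda>k a. \<Sum>l\<in>UNIV. ?N a l * ?P k l" and z = "\<lambda>k. axis k 1"])
        (intro linear_mult_sum linear_nabla_Pil u mform_axis)+
    also have "\<dots> = (\<Sum>a\<in>UNIV. \<Sum>b\<in>UNIV. ginv u a b *
       mform \<eta> (x u) (second_form u (axis c 1) (axis b 1)) (second_form u (axis a 1) (axis d 1)))"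
    proof (intro sum.cong refl arg_cong[where f = "(*) _"])
      fix a b
      have "(\<Sum>k\<in>UNIV. (\<eta> (x u) *v e u b) $ k * (\<Sum>l\<in>UNIV. ?N (axis a 1) l * ?P k l)) =
        (\<Sum>l\<in>UNIV. ?N (axis a 1) l * (\<Sum>k\<in>UNIV. (\<eta> (x u) *v e u b) $ k * ?P k l))"
        unfolding nabla_Pil_tangent[OF u] sum_distrib_left by (subst sum.swap) (simp add: mult_ac)
      also have "\<dots> = mform \<eta> (x u) (second_form u (axis c 1) (axis b 1)) (second_form u (axis a 1) (axis d 1))"
        using sum_mform[of "second_form u (axis c 1) (axis b 1)" "x u" "second_form u (axis a 1) (axis d 1)"]
        unfolding nabla_Pil_tangent[OF u] nabla_Piu_tangent[OF u] by (simp add: mult.commute)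
      finally show "(\<Sum>k\<in>UNIV. (\<eta> (x u) *v e u b) $ k * (\<Sum>l\<in>UNIV. ?N (axis a 1) l * ?P k l)) =
        mform \<eta> (x u) (second_form u (axis c 1) (axis b 1)) (second_form u (axis a 1) (axis d 1))" .
    qed
    finally show "(\<Sum>i\<in>UNIV. e u d $ i * (\<Sum>k\<in>UNIV. \<Sum>l\<in>UNIV. nabla_Pil u (tcomp u (axis k 1)) i l * ?P k l)) =
      (\<Sum>a\<in>UNIV. \<Sum>b\<in>UNIV. ginv u a b *
       mform \<eta> (x u) (second_form u (axis c 1) (axis b 1)) (second_form u (axis a 1) (axis d 1)))" .
  qed
  finally show ?thesis .
qed

text \<open>Tracing \<open>ricci_gauss\<close> over constant coordinate fields, rather than the
  ambient Ricci formula, gives the three expressions in second fundamental forms to which the stated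
  contractions reduce.\<close>

lemma scalar_curvature_formula:
  assumes u: "u \<in> U"
  shows "scalar_curvature g u =
            (\<Sum>i\<in>UNIV. \<Sum>j\<in>UNIV. \<Sum>k\<in>UNIV. \<Sum>l\<in>UNIV.
                D u $ i $ j * D u $ k $ l * riemann_low \<eta> k i l j (x u))
            + (\<Sum>i\<in>UNIV. \<Sum>k\<in>UNIV. \<Sum>l\<in>UNIV.
                hatr_low \<eta> x D Pil k k l u * hat_up \<eta> x D Piu i i l u)
            - (\<Sum>i\<in>UNIV. \<Sum>k\<in>UNIV. \<Sum>l\<in>UNIV.
                hat_low \<eta> x D Pil k i l u * hatr_up \<eta> x D Piu i k l u)"
proof -
  have "(\<Sum>i\<in>UNIV. \<Sum>j\<in>UNIV. \<Sum>k\<in>UNIV. \<Sum>l\<in>UNIV.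
                D u $ i $ j * D u $ k $ l * riemann_low \<eta> k i l j (x u)) =
     (\<Sum>i\<in>UNIV. \<Sum>j\<in>UNIV. D u $ i $ j * (\<Sum>k\<in>UNIV. \<Sum>l\<in>UNIV. D u $ k $ l * riemann_low \<eta> k i l j (x u)))"
    by (simp add: sum_distrib_left mult.assoc)
  also have "\<dots> = (\<Sum>c\<in>UNIV. \<Sum>d\<in>UNIV. ginv u c d * (\<Sum>a\<in>UNIV. \<Sum>b\<in>UNIV. ginv u a b *
       mform \<eta> (x u) (e u b) (curv \<eta> (x u) (e u a) (e u c) (e u d))))"
    unfolding D_contract[OF u, of "\<lambda>i j. \<Sum>k\<in>UNIV. \<Sum>l\<in>UNIV. D u $ k $ l * riemann_low \<eta> k i l j (x u)"]
      curvature_term[OF u] by (rule refl)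
  finally have 1: "(\<Sum>i\<in>UNIV. \<Sum>j\<in>UNIV. \<Sum>k\<in>UNIV. \<Sum>l\<in>UNIV.
                D u $ i $ j * D u $ k $ l * riemann_low \<eta> k i l j (x u)) =
     (\<Sum>c\<in>UNIV. \<Sum>d\<in>UNIV. ginv u c d * (\<Sum>a\<in>UNIV. \<Sum>b\<in>UNIV. ginv u a b *
       mform \<eta> (x u) (e u b) (curv \<eta> (x u) (e u a) (e u c) (e u d))))" .
  have "(\<Sum>i\<in>UNIV. \<Sum>k\<in>UNIV. \<Sum>l\<in>UNIV. hatr_low \<eta> x D Pil k k l u * hat_up \<eta> x D Piu i i l u) =
      mform \<eta> (x u) (trace_second_form u) (trace_second_form u)"
    unfolding sum_product_common_index hat_up_trace[OF u] hatr_low_trace[OF u]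
    using sum_mform[of "trace_second_form u" "x u" "trace_second_form u"] by (simp add: mult.commute)
  also have "\<dots> = (\<Sum>c\<in>UNIV. \<Sum>d\<in>UNIV. ginv u c d *
      mform \<eta> (x u) (trace_second_form u) (second_form u (axis c 1) (axis d 1)))"
    by (subst (2) trace_second_form_def) (simp add: mform_linear)
  finally have 2: "(\<Sum>i\<in>UNIV. \<Sum>k\<in>UNIV. \<Sum>l\<in>UNIV. hatr_low \<eta> x D Pil k k l u * hat_up \<eta> x D Piu i i l u) =
     (\<Sum>c\<in>UNIV. \<Sum>d\<in>UNIV. ginv u c d * mform \<eta> (x u) (trace_second_form u) (second_form u (axis c 1) (axis d 1)))" .
  show ?thesis
    unfolding 1 2 second_form_norm_term[OF u] scalar_curvature_def
      ricci_gauss[OF u smooth_on_const smooth_on_const]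
    by (simp only: distrib_left right_diff_distrib sum.distrib sum_subtractf)
qed

end

text \<open>The normalisation in \<open>D\<close> undoes the factor in the compatibility relation:
  \<epsilon> squares to 1 and \<gamma> is nonzero on \<open>U\<close>.\<close>

lemma bracket_D_eq:
  assumes "compatible_bracket N br \<eta> U x \<gamma> \<epsilon>" "u \<in> U"
  shows "bracket_D N br \<eta> x \<gamma> \<epsilon> u $ i $ j = (\<Sum>a\<in>UNIV. \<Sum>b\<in>UNIV.
      matrix_inv (induced_metric \<eta> x u) $ a $ b * pd a x u $ i * pd b x u $ j)"
  using assms by (auto simp: compatible_bracket_def bracket_D_def power2_eq_square)

theorem proposition3p11:
  fixes V :: "(real^'m::finite) set" and \<eta> :: "real^'m \<Rightarrow> real^'m^'m"
    and U :: "(real^'n::finite) set" and x :: "real^'n \<Rightarrow> real^'m"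
    and N :: nat and br :: "(real^'n \<Rightarrow> real) list \<Rightarrow> real^'n \<Rightarrow> real"
    and \<gamma> :: "real^'n \<Rightarrow> real" and \<epsilon> :: real
    and g :: "real^'n \<Rightarrow> real^'n^'n" and D Piu Pil :: "real^'n \<Rightarrow> real^'m^'m"
  assumes "pseudo_riemannian_metric V \<eta>"
    and "submanifold_patch V \<eta> U x"
    and "multi_derivation_bracket U N br"
    and "compatible_bracket N br \<eta> U x \<gamma> \<epsilon>"
    and "g = induced_metric \<eta> x"
    and "D = bracket_D N br \<eta> x \<gamma> \<epsilon>"
    and "Piu = Pi_up \<eta> x D"
    and "Pil = Pi_low \<eta> x D"
  shows "(\<forall>X Y :: real^'n \<Rightarrow> real^'n. smooth_on U X \<and> smooth_on U Y \<longrightarrow>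
            (\<forall>u\<in>U. ricci g X Y u =
               (\<Sum>i\<in>UNIV. \<Sum>j\<in>UNIV.
                  ((\<Sum>k\<in>UNIV. \<Sum>l\<in>UNIV. D u $ k $ l * riemann_low \<eta> k i l j (x u))
                   + (\<Sum>k\<in>UNIV. \<Sum>l\<in>UNIV. hat_up \<eta> x D Piu k k l u * hat_low \<eta> x D Pil j i l u)
                   - (\<Sum>k\<in>UNIV. \<Sum>l\<in>UNIV. hat_low \<eta> x D Pil k l i u * hat_up \<eta> x D Piu j l k u))
                  * frechet_derivative x (at u) (X u) $ i
                  * frechet_derivative x (at u) (Y u) $ j)))
       \<and> (\<forall>u\<in>U. scalar_curvature g u =
            (\<Sum>i\<in>UNIV. \<Sum>j\<in>UNIV. \<Sum>k\<in>UNIV. \<Sum>l\<in>UNIV.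
                D u $ i $ j * D u $ k $ l * riemann_low \<eta> k i l j (x u))
            + (\<Sum>i\<in>UNIV. \<Sum>k\<in>UNIV. \<Sum>l\<in>UNIV.
                hatr_low \<eta> x D Pil k k l u * hat_up \<eta> x D Piu i i l u)
            - (\<Sum>i\<in>UNIV. \<Sum>k\<in>UNIV. \<Sum>l\<in>UNIV.
                hat_low \<eta> x D Pil k i l u * hatr_up \<eta> x D Piu i k l u))"
proof -
  interpret projected_patch V \<eta> U x D
    using assms by unfold_locales (auto simp: bracket_D_eq)
  show ?thesis
    unfolding assms(5,7,8) using ricci_formula scalar_curvature_formula by blast
qed

end
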